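(* Let $\hat{\boldsymbol\theta}$ denote the maximum likelihood estimate (MLE) in a logistic model with regression vector $\boldsymbol\theta\in\mathbb{R}^p$ and covariates drawn i.i.d. from $\mathcal N(\boldsymbol 0,\boldsymbol I_p)$, based on $n$ observations. Define the random variables $$\alpha(n)=\frac{\langle\hat{\boldsymbol\theta},\boldsymbol\theta\rangle}{\|\boldsymbol\theta\|^2}\qquad\text{and}\qquad \sigma^2(n)=\|P_{\boldsymbol\theta^\perp}\hat{\boldsymbol\theta}\|^2,$$ where $P_{\boldsymbol\theta^\perp}$ is the projection onto $\boldsymbol\theta^\perp$, the orthogonal complement of $\boldsymbol\theta$. Then $$\frac{\hat{\boldsymbol\theta}-\alpha(n)\boldsymbol\theta}{\sigma(n)}$$ is uniformly distributed on the unit sphere lying in $\boldsymbol\theta^\perp$.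
   Context: Logistic model: the observations $(\boldsymbol x_i,y_i)_{i=1}^n$ are independent, $\boldsymbol x_i\sim\mathcal N(\boldsymbol 0,\boldsymbol I_p)$, $y_i\in\{-1,1\}$ and $\mathbb P(y_i=1\mid\boldsymbol x_i)=1/(1+e^{-\boldsymbol x_i^\top\boldsymbol\theta})$. The MLE $\hat{\boldsymbol\theta}$ maximizes over $\boldsymbol b\in\mathbb{R}^p$ the log-likelihood $\sum_{i=1}^n-\log(1+\exp(-y_i\boldsymbol x_i^\top\boldsymbol b))$. The statement is a finite-sample one, for every choice of $n$ and $p$.
   Formalization: Since the MLE fails to exist with positive probability (separable data), the law is taken conditionally on the event that the MLE exists, assumed to have positive probability; also n ≥ 1, p ≥ 2 and θ ≠ 0 are assumed so that all objects are defined. *)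

theory Defs
  imports "HOL-Probability.Probability"
begin

definition std_gaussian_density :: "'a::euclidean_space \<Rightarrow> real" where
  "std_gaussian_density x = exp (- (norm x)\<^sup>2 / 2) / sqrt (2 * pi) ^ DIM('a)"

text \<open>
  The sample has size \<open>n\<close>; only the indices \<open>i < n\<close> of \<open>X\<close> and \<open>Y\<close> are used.  Independence is that
  of the pairs \<open>(X i, Y i)\<close>.  The last clause is \<open>P(Y i = 1 | X i) = 1 / (1 + exp (- X i \<bullet> \<theta>))\<close> a.s.,
  as a conditional expectation given the sigma-algebra generated by \<open>X i\<close>.
\<close>

definition logistic_model ::
  "'w measure \<Rightarrow> nat \<Rightarrow> 'a::euclidean_space \<Rightarrow> (nat \<Rightarrow> 'w \<Rightarrow> 'a) \<Rightarrow> (nat \<Rightarrow> 'w \<Rightarrow> real) \<Rightarrow> bool" where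
  "logistic_model M n \<theta> X Y \<longleftrightarrow>
     prob_space M \<and>
     prob_space.indep_vars M (\<lambda>_. borel \<Otimes>\<^sub>M borel) (\<lambda>i \<omega>. (X i \<omega>, Y i \<omega>)) {..<n} \<and>
     (\<forall>i<n. distributed M lborel (X i) (\<lambda>x. ennreal (std_gaussian_density x))) \<and>
     (\<forall>i<n. \<forall>\<omega>\<in>space M. Y i \<omega> \<in> {-1, 1}) \<and>
     (\<forall>i<n. AE \<omega> in M.
        real_cond_exp M (vimage_algebra (space M) (X i) borel)
          (indicator {\<omega> \<in> space M. Y i \<omega> = 1}) \<omega>
        = 1 / (1 + exp (- (X i \<omega> \<bullet> \<theta>))))"

definition log_likelihood ::
  "nat \<Rightarrow> (nat \<Rightarrow> 'a::euclidean_space) \<Rightarrow> (nat \<Rightarrow> real) \<Rightarrow> 'a \<Rightarrow> real" where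
  "log_likelihood n x y b = (\<Sum>i<n. - ln (1 + exp (- y i * (x i \<bullet> b))))"

definition is_mle ::
  "nat \<Rightarrow> (nat \<Rightarrow> 'a::euclidean_space) \<Rightarrow> (nat \<Rightarrow> real) \<Rightarrow> 'a \<Rightarrow> bool" where
  "is_mle n x y b \<longleftrightarrow> is_arg_max (log_likelihood n x y) (\<lambda>_. True) b"

text \<open>
  For every \<open>n \<ge> 1\<close> the data are linearly separable with positive probability, and then the
  likelihood has no maximizer, so statements about the MLE are conditional on this event.
\<close>

definition mle_exists_event ::
  "'w measure \<Rightarrow> nat \<Rightarrow> (nat \<Rightarrow> 'w \<Rightarrow> 'a::euclidean_space) \<Rightarrow> (nat \<Rightarrow> 'w \<Rightarrow> real) \<Rightarrow> 'w set" where
  "mle_exists_event M n X Y = {\<omega> \<in> space M. \<exists>b. is_mle n (\<lambda>i. X i \<omega>) (\<lambda>i. Y i \<omega>) b}"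

definition alpha :: "'a::euclidean_space \<Rightarrow> 'a \<Rightarrow> real" where
  "alpha \<theta> b = (b \<bullet> \<theta>) / (norm \<theta>)\<^sup>2"

definition sigma_sq :: "'a::euclidean_space \<Rightarrow> 'a \<Rightarrow> real" where
  "sigma_sq \<theta> b = (norm (closest_point ({\<theta>}\<^sup>\<bottom>) b))\<^sup>2"

definition orthonormal_basis_of :: "'a::euclidean_space set \<Rightarrow> 'a set \<Rightarrow> bool" where
  "orthonormal_basis_of V B \<longleftrightarrow>
     pairwise orthogonal B \<and> (\<forall>b\<in>B. norm b = 1) \<and> span B = V"

text \<open>
  Lebesgue measure of dimension \<open>dim V\<close> on a linear subspace \<open>V\<close>, viewed as a Borel measure on the
  ambient space.  This is the formula \<open>lborel_eq\<close> for \<open>lborel\<close>, with an orthonormal basis of \<open>V\<close> in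
  place of \<open>Basis\<close>; the choice of basis is immaterial because orthogonal maps preserve Lebesgue
  measure.
\<close>

definition subspace_lborel :: "'a::euclidean_space set \<Rightarrow> 'a measure" where
  "subspace_lborel V =
     (let B = (SOME B. orthonormal_basis_of V B)
      in distr (\<Pi>\<^sub>M b\<in>B. lborel) borel (\<lambda>f. \<Sum>b\<in>B. f b *\<^sub>R b))"

text \<open>
  Uniform distribution (normalized surface measure) on the unit sphere \<open>V \<inter> sphere 0 1\<close> of \<open>V\<close>: by
  polar coordinates, a set \<open>A\<close> of unit vectors has normalized surface measure
  \<open>vol {r u | u \<in> A, 0 < r \<le> 1} / vol (V \<inter> cball 0 1)\<close>.  It is thus the image of the uniform
  distribution on the unit ball of \<open>V\<close> under \<open>sgn x = x /\<^sub>R norm x\<close>.  This needs \<open>dim V \<ge> 1\<close>.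
\<close>

definition uniform_on_unit_sphere :: "'a::euclidean_space set \<Rightarrow> 'a measure" where
  "uniform_on_unit_sphere V = distr (uniform_measure (subspace_lborel V) (cball 0 1)) borel sgn"

end

theory Submission
  imports Defs
begin

text \<open>
  A reflection \<open>R\<close> along a vector orthogonal to \<open>\<theta>\<close> fixes \<open>\<theta>\<close> and preserves the Gaussian law, so
  replacing every \<open>X i\<close> by \<open>R (X i)\<close> does not change the law of the data, while it turns the MLE into
  its image under \<open>R\<close>.  The conditional law of the direction of the MLE within \<open>\<theta>\<^sup>\<bottom>\<close> is therefore
  invariant under these reflections, which act transitively on the unit sphere of \<open>\<theta>\<^sup>\<bottom>\<close>.  Hence balls of
  equal radius centred on the sphere have equal mass, and by a theorem of Christensen this property
  determines a probability measure; the uniform distribution has it as well.  Two null sets must be excluded: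
  there the maximizer is not unique or is a multiple of \<open>\<theta>\<close>.
\<close>

section \<open>Measures with equal masses on balls\<close>

text \<open>The estimator is just some measurable function that maximizes the likelihood wherever a
  maximizer exists. It need not be a function of the data, so invariance of the law of the data says
  nothing about it directly. The link is the event that the data have a maximizer in a given set: it
  is determined by the data, and almost surely on the existence event it says that the estimator
  lies in that set. This is where uniqueness enters. Such events are shown measurable for open and
  closed sets, and a comparison through balls asks for no more, because the vectors whose direction
  lies in a ball form an open set once the multiples of \<theta> are removed. Balls also avoid Haar
  measure on the orthogonal group, and the mass of a ball is never computed: a double integral shows
  that it agrees for both measures. The uniform distribution rests on Lebesgue measure in a basis
  picked by choice; its invariance follows from translation invariance by the same uniqueness
  theorem.\<close>

text \<open>Christensen's argument: integrate the mass of \<open>ball x r\<close> over those \<open>x\<close> whose ball lies in \<open>G\<close>,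
  and exchange the order of integration.\<close>

lemma ball_mass_dominates:
  fixes \<mu> \<nu> :: "'a::{metric_space, second_countable_topology} measure"
  assumes [measurable_cong, simp]: "sets \<mu> = sets borel" "sets \<nu> = sets borel"
    and "sigma_finite_measure \<mu>" "sigma_finite_measure \<nu>"
    and S: "AE x in \<mu>. x \<in> S" "AE x in \<nu>. x \<in> S"
    and mass: "\<And>x r. x \<in> S \<Longrightarrow> 0 < r \<Longrightarrow> emeasure \<mu> (ball x r) = h r"
      "\<And>x r. x \<in> S \<Longrightarrow> 0 < r \<Longrightarrow> emeasure \<nu> (ball x r) = h r"
    and h: "\<And>r. 0 < r \<Longrightarrow> h r \<noteq> 0" "\<And>r. 0 < r \<Longrightarrow> h r \<noteq> \<infinity>"
    and "open G"
  shows "emeasure \<nu> G \<le> emeasure \<mu> G"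
proof -
  interpret m: sigma_finite_measure \<mu> by fact
  interpret n: sigma_finite_measure \<nu> by fact
  interpret nm: pair_sigma_finite \<nu> \<mu> ..
  define core where "core r = {x. ball x r \<subseteq> G}" for r
  have [measurable]: "G \<in> sets borel" using \<open>open G\<close> by simp
  have closed_core: "closed (core r)" for r
  proof -
    have "- core r = (\<Union>y\<in>-G. ball y r)"
      by (auto simp: core_def dist_commute subset_iff)
    then show ?thesis by (metis closed_def open_UN open_ball)
  qed
  then have core_meas [measurable]: "core r \<in> sets borel" for r by simp
  have core_le: "emeasure \<nu> (core r) \<le> emeasure \<mu> G" if "0 < r" for r
  proof -
    have "h r * emeasure \<nu> (core r) = (\<integral>\<^sup>+x. h r * indicator (core r) x \<partial>\<nu>)"
      by (simp add: nn_integral_cmult_indicator)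
    also have "\<dots> = (\<integral>\<^sup>+x. indicator (core r) x * emeasure \<mu> (ball x r) \<partial>\<nu>)"
      using S(2) by (intro nn_integral_cong_AE) (auto simp: mass \<open>0 < r\<close> mult.commute)
    also have "\<dots> = (\<integral>\<^sup>+x. \<integral>\<^sup>+y. indicator (core r) x * indicator (ball x r) y \<partial>\<mu> \<partial>\<nu>)"
      by (simp add: nn_integral_cmult_indicator)
    \<comment> \<open>The only lossy step: for \<open>x\<close> in the core, every \<open>y\<close>
      in \<open>ball x r\<close> lies in \<open>G\<close>. The symmetric relation
      \<open>dist x y < r\<close> is then read from the side of \<open>y\<close>.\<close>
    also have "\<dots> \<le> (\<integral>\<^sup>+x. \<integral>\<^sup>+y. indicator G y * indicator (ball y r) x \<partial>\<mu> \<partial>\<nu>)"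
      by (intro nn_integral_mono) (auto simp: indicator_def core_def dist_commute)
    also have "\<dots> = (\<integral>\<^sup>+y. \<integral>\<^sup>+x. indicator G y * indicator {(x, y). dist x y < r} (x, y) \<partial>\<nu> \<partial>\<mu>)"
      by (subst nm.Fubini') (auto simp: indicator_def dist_commute intro!: nn_integral_cong)
    also have "\<dots> = (\<integral>\<^sup>+y. \<integral>\<^sup>+x. indicator G y * indicator (ball y r) x \<partial>\<nu> \<partial>\<mu>)"
      by (auto simp: indicator_def dist_commute intro!: nn_integral_cong)
    also have "\<dots> = (\<integral>\<^sup>+y. indicator G y * emeasure \<nu> (ball y r) \<partial>\<mu>)"
      by (simp add: nn_integral_cmult_indicator)
    also have "\<dots> = (\<integral>\<^sup>+x. h r * indicator G x \<partial>\<mu>)"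
      using S(1) by (intro nn_integral_cong_AE) (auto simp: mass \<open>0 < r\<close> mult.commute)
    also have "\<dots> = h r * emeasure \<mu> G"
      by (simp add: nn_integral_cmult_indicator)
    finally show ?thesis
      using h[OF \<open>0 < r\<close>] by (metis ennreal_mult_le_mult_iff infinity_ennreal_def)
  qed
  define C where "C n = core (inverse (real (Suc n)))" for n
  have "(\<Union>n. C n) = G"
  proof (intro equalityI subsetI)
    fix x assume "x \<in> G"
    then obtain e where e: "e > 0" "ball x e \<subseteq> G" using \<open>open G\<close> open_contains_ball by blast
    then obtain n where "inverse (real (Suc n)) < e" using reals_Archimedean by blast
    then have "x \<in> C n" using e by (auto simp: C_def core_def subset_iff)
    then show "x \<in> (\<Union>n. C n)" by blast
  next
    fix x assume "x \<in> (\<Union>n. C n)"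
    then show "x \<in> G" by (auto simp: C_def core_def subset_iff)
  qed
  moreover have "incseq C"
  proof (rule incseq_SucI)
    fix n
    have "inverse (real (Suc (Suc n))) \<le> inverse (real (Suc n))" by (simp add: field_simps)
    then show "C n \<subseteq> C (Suc n)" unfolding C_def core_def using subset_ball by (blast intro: order_trans)
  qed
  ultimately have "(SUP n. emeasure \<nu> (C n)) = emeasure \<nu> G"
    using SUP_emeasure_incseq[of C \<nu>] core_meas by (auto simp: C_def image_subset_iff)
  then show ?thesis using core_le by (metis C_def SUP_least inverse_positive_iff_positive of_nat_0_less_iff zero_less_Suc)
qed

text \<open>By Lindelof, countably many of the null balls already cover \<open>S\<close>.\<close>

lemma emeasure_zero_if_balls_null:
  fixes \<mu> :: "'a::{metric_space, second_countable_topology} measure"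
  assumes sets: "sets \<mu> = sets borel" and S: "AE x in \<mu>. x \<in> S" and "0 < r"
    and null: "\<And>x. x \<in> S \<Longrightarrow> emeasure \<mu> (ball x r) = 0"
  shows "emeasure \<mu> UNIV = 0"
proof -
  have space: "space \<mu> = UNIV" using sets_eq_imp_space_eq[OF sets] by simp
  obtain F where F: "F \<subseteq> (\<lambda>x. ball x r) ` S" "countable F" "\<Union>F = (\<Union>x\<in>S. ball x r)"
    by (rule Lindelof[of "(\<lambda>x. ball x r) ` S"]) auto
  have "(\<Union>A\<in>F. A) \<in> null_sets \<mu>"
    using F null by (intro null_sets_UN') (auto simp: sets null_sets_def)
  then have "AE x in \<mu>. x \<notin> (\<Union>x\<in>S. ball x r)"
    unfolding F(3)[symmetric] by (intro AE_not_in) simp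
  with S have "AE x in \<mu>. False"
    by eventually_elim (metis UN_I \<open>0 < r\<close> centre_in_ball)
  then show ?thesis by (simp add: eventually_False ae_filter_eq_bot_iff space)
qed

text \<open>Domination in both directions gives equality on open sets, which form a generator stable
  under intersection. Positivity of \<open>h\<close> is derived: a radius at which all balls are
  null would make \<mu> null. Balls around one point of \<open>S\<close> supply
  sigma-finiteness.\<close>

lemma measure_eq_if_ball_masses_eq:
  fixes \<mu> \<nu> :: "'a::{metric_space, second_countable_topology} measure"
  assumes sets: "sets \<mu> = sets borel" "sets \<nu> = sets borel"
    and S: "AE x in \<mu>. x \<in> S" "AE x in \<nu>. x \<in> S"
    and mass: "\<And>x r. x \<in> S \<Longrightarrow> 0 < r \<Longrightarrow> emeasure \<mu> (ball x r) = h r"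
      "\<And>x r. x \<in> S \<Longrightarrow> 0 < r \<Longrightarrow> emeasure \<nu> (ball x r) = h r"
    and finite: "\<And>r. 0 < r \<Longrightarrow> h r \<noteq> \<infinity>"
    and nonzero: "emeasure \<mu> UNIV \<noteq> 0"
  shows "\<mu> = \<nu>"
proof -
  note [measurable_cong] = sets
  have space: "space \<mu> = UNIV" "space \<nu> = UNIV" 
    using sets_eq_imp_space_eq[OF sets(1)] sets_eq_imp_space_eq[OF sets(2)] by simp_all
  have "S \<noteq> {}"
  proof
    assume "S = {}"
    then have "AE x in \<mu>. False" using S(1) by simp
    then show False using nonzero by (simp add: AE_iff_measurable[OF _ refl] space)
  qed
  then obtain a where a: "a \<in> S" by blast
  have pos: "h r \<noteq> 0" if "0 < r" for r
    using emeasure_zero_if_balls_null[OF sets(1) S(1) that] mass(1) that nonzero by metis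
  have cover: "(\<Union>n. ball a (real (Suc n))) = UNIV"
  proof (intro equalityI subsetI UNIV_I)
    fix x
    obtain n where "dist a x < real n" using reals_Archimedean2 by blast
    then have "x \<in> ball a (real (Suc n))" by simp
    then show "x \<in> (\<Union>n. ball a (real (Suc n)))" by blast
  qed
  have sf: "sigma_finite_measure \<rho>"
    if "sets \<rho> = sets borel" "\<And>r. 0 < r \<Longrightarrow> emeasure \<rho> (ball a r) = h r" for \<rho> :: "'a measure"
  proof
    let ?B = "range (\<lambda>n. ball a (real (Suc n)))"
    have "?B \<subseteq> sets \<rho>"
      unfolding that(1) by (intro image_subsetI borel_open open_ball)
    moreover have "\<Union>?B = space \<rho>" using cover sets_eq_imp_space_eq[OF that(1)] by simp
    moreover have "\<forall>B\<in>?B. emeasure \<rho> B \<noteq> \<infinity>"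
    proof
      fix B assume "B \<in> ?B"
      then obtain n where "B = ball a (real (Suc n))" by blast
      then show "emeasure \<rho> B \<noteq> \<infinity>"
        by (simp only: that(2) finite of_nat_0_less_iff zero_less_Suc not_False_eq_True)
    qed
    ultimately show "\<exists>A. countable A \<and> A \<subseteq> sets \<rho> \<and> \<Union>A = space \<rho> \<and> (\<forall>B\<in>A. emeasure \<rho> B \<noteq> \<infinity>)"
      by (intro exI[of _ ?B] conjI countable_image) auto
  qed
  have sf: "sigma_finite_measure \<mu>" "sigma_finite_measure \<nu>"
    by (rule sf; intro sets mass a; assumption)+
  have le: "emeasure \<mu> G = emeasure \<nu> G" if "open G" for G
    using ball_mass_dominates[OF sets(1,2) sf S mass pos finite that]
      ball_mass_dominates[OF sets(2,1) sf(2,1) S(2,1) mass(2,1) pos finite that]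
    by (rule antisym[rotated])
  show ?thesis
  proof (rule measure_eqI_generator_eq[where E="{G. open G}" and \<Omega>=UNIV and A="\<lambda>n. ball a (real (Suc n))"])
    show "sets \<mu> = sigma_sets UNIV {G. open G}" "sets \<nu> = sigma_sets UNIV {G. open G}"
      by (simp_all add: sets borel_def)
  qed (use cover in \<open>auto simp: Int_stable_def le mass a finite[simplified]\<close>)
qed

text \<open>Both constants are the product measure of the set of pairs at distance less than
  \<open>r\<close>, integrated in the two possible orders.\<close>

lemma ball_masses_eq:
  fixes \<mu> \<nu> :: "'a::{metric_space, second_countable_topology} measure"
  assumes [measurable_cong, simp]: "sets \<mu> = sets borel" "sets \<nu> = sets borel"
    and "prob_space \<mu>" "prob_space \<nu>"
    and S: "AE x in \<mu>. x \<in> S" "AE x in \<nu>. x \<in> S"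
    and mass: "\<And>x. x \<in> S \<Longrightarrow> emeasure \<mu> (ball x r) = h" "\<And>x. x \<in> S \<Longrightarrow> emeasure \<nu> (ball x r) = k"
  shows "h = k"
proof -
  interpret m: prob_space \<mu> by fact
  interpret n: prob_space \<nu> by fact
  interpret nm: pair_sigma_finite \<nu> \<mu> ..
  have "h = (\<integral>\<^sup>+x. h \<partial>\<nu>)" by (simp add: n.emeasure_space_1)
  also have "\<dots> = (\<integral>\<^sup>+x. emeasure \<mu> (ball x r) \<partial>\<nu>)"
    using S(2) by (intro nn_integral_cong_AE) (auto simp: mass)
  also have "\<dots> = (\<integral>\<^sup>+x. \<integral>\<^sup>+y. indicator {(x, y). dist x y < r} (x, y) \<partial>\<mu> \<partial>\<nu>)"
    by (auto intro!: nn_integral_cong simp flip: nn_integral_indicator simp: indicator_def assms(1))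
  also have "\<dots> = (\<integral>\<^sup>+y. \<integral>\<^sup>+x. indicator {(x, y). dist x y < r} (x, y) \<partial>\<nu> \<partial>\<mu>)"
    by (rule nm.Fubini'[symmetric]) measurable
  also have "\<dots> = (\<integral>\<^sup>+y. emeasure \<nu> (ball y r) \<partial>\<mu>)"
    by (auto intro!: nn_integral_cong simp flip: nn_integral_indicator simp: indicator_def dist_commute assms(2))
  also have "\<dots> = (\<integral>\<^sup>+x. k \<partial>\<mu>)"
    using S(1) by (intro nn_integral_cong_AE) (auto simp: mass)
  also have "\<dots> = k" by (simp add: m.emeasure_space_1)
  finally show ?thesis .
qed

section \<open>Reflections\<close>

text \<open>Reflection in the hyperplane orthogonal to \<open>a\<close>. For \<open>a = 0\<close>
  the division by zero yields the identity, so the algebraic laws hold for every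
  \<open>a\<close>.\<close>

definition reflect :: "'a::real_inner \<Rightarrow> 'a \<Rightarrow> 'a" where
  "reflect a x = x - (2 * (a \<bullet> x) / (a \<bullet> a)) *\<^sub>R a"

lemma reflect_reflect [simp]: "reflect a (reflect a x) = x"
  by (cases "a = 0") (simp_all add: reflect_def inner_diff_right scaleR_left_diff_distrib)

lemma inner_reflect_left: "reflect a x \<bullet> y = x \<bullet> reflect a y"
  by (simp add: reflect_def inner_diff_left inner_diff_right inner_commute)

lemma inner_reflect [simp]: "reflect a x \<bullet> reflect a y = x \<bullet> y"
  by (simp add: inner_reflect_left)

lemma norm_reflect [simp]: "norm (reflect a x) = norm x"
  by (simp add: norm_eq_sqrt_inner)

lemma linear_reflect: "linear (reflect a)"
  by (rule linearI)
    (simp_all add: reflect_def inner_add_right inner_scaleR_right add_divide_distrib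
      scaleR_left_distrib distrib_left algebra_simps)

lemma dist_reflect [simp]: "dist (reflect a x) (reflect a y) = dist x y"
  by (metis dist_norm linear_diff linear_reflect norm_reflect)

lemma measurable_reflect [measurable]:
  "reflect (a::'a::euclidean_space) \<in> borel_measurable borel"
  unfolding reflect_def[abs_def] by measurable

lemma reflect_fixes: "a \<bullet> x = 0 \<Longrightarrow> reflect a x = x"
  by (simp add: reflect_def)

lemma sgn_reflect: "sgn (reflect a x) = reflect a (sgn x)"
  by (simp add: sgn_div_norm linear_scale[OF linear_reflect])

lemma reflect_mem: "subspace V \<Longrightarrow> a \<in> V \<Longrightarrow> reflect a x \<in> V \<longleftrightarrow> x \<in> V"
  by (metis reflect_def reflect_reflect subspace_diff subspace_scale)

text \<open>Equal norms make \<open>x + y\<close> orthogonal to \<open>x - y\<close>, so the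
  reflection fixes the half-sum and negates the half-difference. For \<open>x\<close> and
  \<open>y\<close> in a subspace the axis \<open>x - y\<close> lies there too, whence transitivity
  on its unit sphere.\<close>

lemma reflect_swap:
  assumes "norm x = norm y"
  shows "reflect (x - y) x = y"
proof (cases "x = y")
  case False
  have "x \<bullet> x = y \<bullet> y" using assms by (simp add: norm_eq)
  then have "2 * ((x - y) \<bullet> x) = (x - y) \<bullet> (x - y)"
    by (simp add: inner_diff_left inner_diff_right inner_commute)
  with False show ?thesis by (simp add: reflect_def)
qed (simp add: reflect_def)

lemma vimage_reflect_ball: "reflect a -` ball x r = ball (reflect a x) r"
proof -
  have "dist x (reflect a y) = dist (reflect a x) y" for y
    by (metis dist_reflect reflect_reflect)
  then show ?thesis by auto
qed

text \<open>A reflection is an isometry that preserves \<open>S\<close>, so the image measure has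
  the same ball masses and the uniqueness theorem applies. This takes the place of a change of
  variables.\<close>

lemma distr_reflect_if_ball_masses_const:
  fixes \<mu> :: "'a::euclidean_space measure"
  assumes sets: "sets \<mu> = sets borel" and S: "AE x in \<mu>. x \<in> S"
    and mass: "\<And>x r. x \<in> S \<Longrightarrow> 0 < r \<Longrightarrow> emeasure \<mu> (ball x r) = h r"
    and finite: "\<And>r. 0 < r \<Longrightarrow> h r \<noteq> \<infinity>" and nonzero: "emeasure \<mu> UNIV \<noteq> 0"
    and a: "\<And>x. x \<in> S \<Longrightarrow> reflect a x \<in> S" and [measurable]: "S \<in> sets borel"
  shows "distr \<mu> borel (reflect a) = \<mu>"
proof -
  note [measurable_cong] = sets
  have space: "space \<mu> = UNIV" using sets_eq_imp_space_eq[OF sets] by simp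
  have "\<mu> = distr \<mu> borel (reflect a)"
  proof (rule measure_eq_if_ball_masses_eq[where S=S and h=h])
    show "AE x in distr \<mu> borel (reflect a). x \<in> S"
      using S a by (subst AE_distr_iff) auto
    show "emeasure (distr \<mu> borel (reflect a)) (ball x r) = h r" if "x \<in> S" "0 < r" for x r
      using that a by (simp add: emeasure_distr space vimage_reflect_ball mass)
  qed (use assms in simp_all)
  then show ?thesis ..
qed

lemma distr_lborel_reflect: "distr lborel borel (reflect a) = (lborel :: 'a::euclidean_space measure)"
  by (rule distr_reflect_if_ball_masses_const[where S=UNIV
        and h="\<lambda>r. ennreal (unit_ball_vol (real DIM('a)) * r ^ DIM('a))"])
    (simp_all add: emeasure_ball)

section \<open>Lebesgue measure on a subspace and the uniform distribution on its sphere\<close>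

lemma distr_PiM_lborel_shift:
  fixes c :: "'i \<Rightarrow> real"
  assumes "finite B"
  shows "distr (\<Pi>\<^sub>M b\<in>B. lborel) (\<Pi>\<^sub>M b\<in>B. lborel) (\<lambda>f. \<lambda>b\<in>B. f b + c b) = (\<Pi>\<^sub>M b\<in>B. lborel)"
proof -
  interpret product_sigma_finite "\<lambda>_. lborel :: real measure" by standard
  show ?thesis
  proof (rule PiM_eqI[OF assms])
    fix A :: "'i \<Rightarrow> real set" assume "\<And>b. b \<in> B \<Longrightarrow> A b \<in> sets lborel"
    then have A [measurable]: "\<And>b. b \<in> B \<Longrightarrow> A b \<in> sets borel" by simp
    have shift: "emeasure lborel ((+) (c b) -` A b) = emeasure lborel (A b)" if "b \<in> B" for b
      using emeasure_distr[of "(+) (c b)" lborel borel "A b"] A[OF that]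
      by (simp add: lborel_distr_plus)
    have "(\<lambda>f. \<lambda>b\<in>B. f b + c b) -` Pi\<^sub>E B A \<inter> space (\<Pi>\<^sub>M b\<in>B. lborel)
        = (\<Pi>\<^sub>E b\<in>B. (+) (c b) -` A b)"
      by (auto simp: space_PiM PiE_iff add.commute)
    moreover have "Pi\<^sub>E B A \<in> sets (\<Pi>\<^sub>M b\<in>B. lborel)"
      using assms A by (intro sets_PiM_I_finite) auto
    moreover have "(+) (c b) -` A b \<in> sets lborel" if "b \<in> B" for b
      using measurable_sets[of "(+) (c b)" borel borel "A b"] A[OF that] by simp
    ultimately show "emeasure (distr (\<Pi>\<^sub>M b\<in>B. lborel) (\<Pi>\<^sub>M b\<in>B. lborel) (\<lambda>f. \<lambda>b\<in>B. f b + c b)) (Pi\<^sub>E B A)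
        = (\<Prod>b\<in>B. emeasure lborel (A b))"
      using assms by (simp add: emeasure_distr emeasure_PiM shift)
  qed simp
qed

text \<open>\<open>B\<close> is meant to be the very basis that \<open>SOME\<close> selects in
  \<open>subspace_lborel\<close>, so independence of the choice need not be shown.\<close>

locale subspace_lborel_basis = product_sigma_finite "\<lambda>_ :: 'a. lborel :: real measure"
  for V B :: "'a::euclidean_space set" +
  assumes finite_B: "finite B"
    and norm_B: "\<And>b. b \<in> B \<Longrightarrow> norm b = 1"
    and span_B: "span B = V"
    and inner_coords: "\<And>f c. c \<in> B \<Longrightarrow> (\<Sum>b\<in>B. f b *\<^sub>R b) \<bullet> c = (f c :: real)"
    and coords_inner: "\<And>x. x \<in> V \<Longrightarrow> (\<Sum>b\<in>B. (x \<bullet> b) *\<^sub>R b) = x"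
    and lborel_B: "subspace_lborel V = distr (\<Pi>\<^sub>M b\<in>B. lborel) borel (\<lambda>f. \<Sum>b\<in>B. f b *\<^sub>R b)"

lemma subspace_lborel_basis_exists:
  fixes V :: "'a::euclidean_space set"
  assumes "subspace V"
  obtains B where "subspace_lborel_basis V B"
proof -
  have "\<exists>B. orthonormal_basis_of V B"
    using orthonormal_basis_subspace[OF assms] unfolding orthonormal_basis_of_def by metis
  then have "orthonormal_basis_of V (SOME B. orthonormal_basis_of V B)" by (rule someI_ex)
  then obtain B where B: "orthonormal_basis_of V B"
    and eq: "subspace_lborel V = distr (\<Pi>\<^sub>M b\<in>B. lborel) borel (\<lambda>f. \<Sum>b\<in>B. f b *\<^sub>R b)"
    unfolding subspace_lborel_def Let_def by blast
  have orth: "pairwise orthogonal B" and norm: "\<And>b. b \<in> B \<Longrightarrow> norm b = 1" and span: "span B = V"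
    using B by (auto simp: orthonormal_basis_of_def)
  have "0 \<notin> B" using norm by force
  then have fin: "finite B"
    using orth pairwise_orthogonal_independent independent_imp_finite by blast
  have inner: "b \<bullet> c = (if b = c then 1 else 0)" if "b \<in> B" "c \<in> B" for b c
    using orth norm that by (auto simp: pairwise_def orthogonal_def norm_eq_1)
  have coord: "(\<Sum>b\<in>B. f b *\<^sub>R b) \<bullet> c = f c" if "c \<in> B" for f and c :: 'a
  proof -
    have "(\<Sum>b\<in>B. f b *\<^sub>R b) \<bullet> c = (\<Sum>b\<in>B. if b = c then f b else 0)"
      unfolding inner_sum_left by (rule sum.cong) (simp_all add: inner that)
    then show ?thesis using that fin by simp
  qed
  have "(\<Sum>b\<in>B. (x \<bullet> b) *\<^sub>R b) = x" if "x \<in> V" for x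
  proof -
    let ?y = "x - (\<Sum>b\<in>B. (x \<bullet> b) *\<^sub>R b)"
    have "?y \<in> span B"
      using that span by (intro span_diff span_sum span_scale) (auto intro: span_base)
    moreover have "orthogonal ?y b" if "b \<in> B" for b
      using that by (simp add: orthogonal_def inner_diff_left coord)
    ultimately have "orthogonal ?y ?y" by (metis orthogonal_to_span)
    then show ?thesis by (simp add: orthogonal_self)
  qed
  then have "subspace_lborel_basis V B"
    by unfold_locales (use fin norm span coord eq in auto)
  then show ?thesis by (rule that)
qed

lemma sets_subspace_lborel [simp, measurable_cong]: "sets (subspace_lborel V) = sets borel"
  by (simp add: subspace_lborel_def Let_def)

lemma space_subspace_lborel [simp]: "space (subspace_lborel V) = UNIV"
  by (simp add: subspace_lborel_def Let_def)

lemma AE_subspace_lborel: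
  fixes V :: "'a::euclidean_space set"
  assumes "subspace V"
  shows "AE x in subspace_lborel V. x \<in> V"
proof -
  obtain B where "subspace_lborel_basis V B"
    using subspace_lborel_basis_exists[OF assms] .
  then interpret subspace_lborel_basis V B .
  have [measurable]: "V \<in> sets borel" using closed_subspace[OF assms] by simp
  show ?thesis
    unfolding lborel_B by (subst AE_distr_iff) (auto simp flip: span_B intro!: AE_I2 span_sum span_scale intro: span_base)
qed

text \<open>Translation by \<open>x\<close> in \<open>V\<close> shifts the coordinate at
  \<open>b\<close> by \<open>x \<bullet> b\<close>, which preserves the product of Lebesgue
  measures.\<close>

lemma emeasure_subspace_lborel_ball:
  fixes V :: "'a::euclidean_space set"
  assumes "subspace V" "x \<in> V"
  shows "emeasure (subspace_lborel V) (ball x r) = emeasure (subspace_lborel V) (ball 0 r)"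
proof -
  obtain B where "subspace_lborel_basis V B"
    using subspace_lborel_basis_exists[OF assms(1)] .
  then interpret subspace_lborel_basis V B .
  let ?P = "\<Pi>\<^sub>M b\<in>B. (lborel :: real measure)"
  let ?shift = "\<lambda>f. \<lambda>b\<in>B. f b + x \<bullet> b"
  have "(\<Sum>b\<in>B. ?shift f b *\<^sub>R b) = (\<Sum>b\<in>B. f b *\<^sub>R b) + x" for f
    using coords_inner[OF assms(2)] by (simp add: scaleR_left_distrib sum.distrib)
  then have "distr ?P borel (\<lambda>f. \<Sum>b\<in>B. f b *\<^sub>R b)
      = distr ?P borel (\<lambda>f. (\<Sum>b\<in>B. f b *\<^sub>R b) + x)"
    by (subst distr_PiM_lborel_shift[OF finite_B, of "\<lambda>b. x \<bullet> b", symmetric])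
      (simp add: distr_distr comp_def)
  moreover have "distr (subspace_lborel V) borel (\<lambda>y. y + x) = distr ?P borel (\<lambda>f. (\<Sum>b\<in>B. f b *\<^sub>R b) + x)"
    unfolding lborel_B by (simp add: distr_distr comp_def)
  ultimately have "subspace_lborel V = distr (subspace_lborel V) borel (\<lambda>y. y + x)"
    using lborel_B by simp
  then have "emeasure (subspace_lborel V) (ball x r)
      = emeasure (distr (subspace_lborel V) borel (\<lambda>y. y + x)) (ball x r)" by simp
  also have "\<dots> = emeasure (subspace_lborel V) ((\<lambda>y. y + x) -` ball x r)"
    by (simp add: emeasure_distr)
  also have "(\<lambda>y. y + x) -` ball x r = ball 0 r"
    by (auto simp: dist_norm)
  finally show ?thesis .
qed

text \<open>By Cauchy-Schwarz the coordinates of a vector are bounded by its norm, so the ball lies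
  in a cube of side \<open>2 * r\<close>.\<close>

lemma emeasure_subspace_lborel_cball_finite:
  fixes V :: "'a::euclidean_space set"
  assumes "subspace V"
  shows "emeasure (subspace_lborel V) (cball 0 r) < \<infinity>"
proof -
  obtain B where "subspace_lborel_basis V B"
    using subspace_lborel_basis_exists[OF assms] .
  then interpret subspace_lborel_basis V B .
  have "\<bar>f c\<bar> \<le> r" if "norm (\<Sum>b\<in>B. f b *\<^sub>R b) \<le> r" "c \<in> B" for f and c :: 'a
    using Cauchy_Schwarz_ineq2[of "\<Sum>b\<in>B. f b *\<^sub>R b" c] inner_coords[of c f] norm_B[of c] that by simp
  then have "emeasure (subspace_lborel V) (cball 0 r)
      \<le> emeasure (\<Pi>\<^sub>M b\<in>B. lborel) (\<Pi>\<^sub>E b\<in>B. {-r..r})"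
    unfolding lborel_B
    by (subst emeasure_distr)
      (auto simp: space_PiM PiE_iff abs_le_iff minus_le_iff intro!: emeasure_mono sets_PiM_I_finite finite_B)
  also have "\<dots> < \<infinity>"
    using finite_B by (subst emeasure_PiM) (auto simp: ennreal_prod_eq_top power_0_left power_less_top_ennreal emeasure_lborel_Icc_eq)
  finally show ?thesis .
qed

lemma emeasure_subspace_lborel_UNIV:
  fixes V :: "'a::euclidean_space set"
  assumes "subspace V"
  shows "emeasure (subspace_lborel V) UNIV \<noteq> 0"
proof -
  obtain B where "subspace_lborel_basis V B"
    using subspace_lborel_basis_exists[OF assms] .
  then interpret subspace_lborel_basis V B .
  have "1 = emeasure (\<Pi>\<^sub>M b\<in>B. lborel) (\<Pi>\<^sub>E b\<in>B. {0..1::real})"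
    using finite_B by (subst emeasure_PiM) auto
  also have "\<dots> \<le> emeasure (\<Pi>\<^sub>M b\<in>B. lborel) (space (\<Pi>\<^sub>M b\<in>B. (lborel :: real measure)))"
    by (rule emeasure_space)
  also have "\<dots> = emeasure (subspace_lborel V) UNIV"
    unfolding lborel_B by (subst emeasure_distr) auto
  finally show ?thesis by (metis not_one_le_zero)
qed

text \<open>The origin has to be negligible because \<open>sgn 0 = 0\<close> is off the sphere. The
  vector \<open>v\<close> forces \<open>B\<close> to be nonempty, so that the product over
  \<open>B\<close> has a vanishing factor.\<close>

lemma emeasure_subspace_lborel_zero:
  fixes V :: "'a::euclidean_space set"
  assumes "subspace V" "v \<in> V" "v \<noteq> 0"
  shows "emeasure (subspace_lborel V) {0} = 0"
proof -
  obtain B where "subspace_lborel_basis V B"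
    using subspace_lborel_basis_exists[OF assms(1)] .
  then interpret subspace_lborel_basis V B .
  have "B \<noteq> {}" using span_B assms by auto
  interpret product_sigma_finite "\<lambda>_. lborel :: real measure" by standard
  have "f c = 0" if "(\<Sum>b\<in>B. f b *\<^sub>R b) = 0" "c \<in> B" for f and c :: 'a
    using inner_coords[of c f] that by simp
  then have sub: "(\<lambda>f. \<Sum>b\<in>B. f b *\<^sub>R b) -` {0} \<inter> space (\<Pi>\<^sub>M b\<in>B. lborel) \<subseteq> (\<Pi>\<^sub>E b\<in>B. {0::real})"
    by (intro subsetI PiE_I) (auto simp: space_PiM PiE_iff extensional_def)
  have "(\<Pi>\<^sub>E b\<in>B. {0::real}) \<in> sets (\<Pi>\<^sub>M b\<in>B. lborel)"
    by (rule sets_PiM_I_finite[OF finite_B]) simp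
  from emeasure_mono[OF sub this] have "emeasure (subspace_lborel V) {0}
      \<le> emeasure (\<Pi>\<^sub>M b\<in>B. lborel) (\<Pi>\<^sub>E b\<in>B. {0::real})"
    unfolding lborel_B by (subst emeasure_distr) simp_all
  also have "\<dots> = 0"
    using finite_B \<open>B \<noteq> {}\<close> by (subst emeasure_PiM) auto
  finally show ?thesis by simp
qed

lemma distr_subspace_lborel_reflect:
  fixes V :: "'a::euclidean_space set"
  assumes "subspace V" "a \<in> V"
  shows "distr (subspace_lborel V) borel (reflect a) = subspace_lborel V"
proof (rule distr_reflect_if_ball_masses_const[where S=V])
  show "emeasure (subspace_lborel V) (ball 0 r) \<noteq> \<infinity>" for r
    using emeasure_mono[OF ball_subset_cball[of 0 r], of "subspace_lborel V"]
      emeasure_subspace_lborel_cball_finite[OF assms(1), of r] by (auto simp: top_unique)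
qed (use assms in \<open>simp_all add: AE_subspace_lborel emeasure_subspace_lborel_ball reflect_mem
    emeasure_subspace_lborel_UNIV closed_subspace\<close>)

text \<open>A null ball would, by translation, make all balls of that radius centred in
  \<open>V\<close> null, and hence the whole measure.\<close>

lemma emeasure_subspace_lborel_cball_pos:
  fixes V :: "'a::euclidean_space set"
  assumes "subspace V" "0 < r"
  shows "emeasure (subspace_lborel V) (cball 0 r) \<noteq> 0"
proof
  assume null: "emeasure (subspace_lborel V) (cball 0 r) = 0"
  have "emeasure (subspace_lborel V) (ball x r) = 0" if "x \<in> V" for x
    using emeasure_mono[OF ball_subset_cball[of 0 r], of "subspace_lborel V"] null
    by (simp add: emeasure_subspace_lborel_ball assms(1) that)
  then show False
    using emeasure_zero_if_balls_null[OF _ AE_subspace_lborel[OF assms(1)] assms(2)]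
      emeasure_subspace_lborel_UNIV[OF assms(1)] by simp
qed

lemma sets_uniform_on_unit_sphere [simp, measurable_cong]:
  "sets (uniform_on_unit_sphere V) = sets borel"
  by (simp add: uniform_on_unit_sphere_def)

text \<open>The vector \<open>v\<close> witnesses that \<open>V\<close> has unit vectors at all.
  Invariance passes from \<open>subspace_lborel V\<close> to the sphere because reflections preserve
  the unit ball and commute with \<open>sgn\<close>.\<close>

lemma uniform_on_unit_sphere:
  fixes V :: "'a::euclidean_space set"
  assumes V: "subspace V" "v \<in> V" "v \<noteq> 0"
  shows prob_space_uniform_on_unit_sphere: "prob_space (uniform_on_unit_sphere V)"
    and AE_uniform_on_unit_sphere: "AE x in uniform_on_unit_sphere V. x \<in> V \<inter> sphere 0 1"
    and distr_uniform_on_unit_sphere_reflect: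
      "a \<in> V \<Longrightarrow> distr (uniform_on_unit_sphere V) borel (reflect a) = uniform_on_unit_sphere V"
proof -
  let ?L = "subspace_lborel V"
  let ?U = "uniform_measure ?L (cball 0 1)"
  note cball = emeasure_subspace_lborel_cball_pos[OF V(1), of 1]
    emeasure_subspace_lborel_cball_finite[OF V(1), of 1]
  interpret U: prob_space ?U by (rule prob_space_uniform_measure) (use cball in auto)
  have [measurable]: "V \<in> sets borel" using closed_subspace[OF V(1)] by simp
  show "prob_space (uniform_on_unit_sphere V)"
    unfolding uniform_on_unit_sphere_def by (rule U.prob_space_distr) simp
  have "AE x in ?L. x \<noteq> 0"
    using emeasure_subspace_lborel_zero[OF V] AE_not_in[of "{0}" ?L] by (auto simp: null_sets_def)
  with AE_subspace_lborel[OF V(1)] have "AE x in ?L. sgn x \<in> V \<inter> sphere 0 1"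
    by eventually_elim (auto simp: sgn_div_norm V(1) subspace_scale)
  then have "AE x in ?U. sgn x \<in> V \<inter> sphere 0 1"
    using cball by (intro AE_uniform_measureI) auto
  then show "AE x in uniform_on_unit_sphere V. x \<in> V \<inter> sphere 0 1"
    unfolding uniform_on_unit_sphere_def by (subst AE_distr_iff) auto
  show "distr (uniform_on_unit_sphere V) borel (reflect a) = uniform_on_unit_sphere V" if "a \<in> V"
  proof (rule measure_eqI)
    fix A assume "A \<in> sets (distr (uniform_on_unit_sphere V) borel (reflect a))"
    then have [measurable]: "A \<in> sets borel" by simp
    let ?C = "cball 0 1 \<inter> sgn -` A"
    have [measurable]: "?C \<in> sets borel" 
      using measurable_sets[of sgn borel borel A] by auto
    have *: "reflect a -` ?C = cball 0 1 \<inter> sgn -` reflect a -` A"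
      by (auto simp: sgn_reflect)
    have "emeasure ?L ?C = emeasure (distr ?L borel (reflect a)) ?C"
      by (simp add: distr_subspace_lborel_reflect V that)
    also have "\<dots> = emeasure ?L (cball 0 1 \<inter> sgn -` reflect a -` A)"
      by (simp add: emeasure_distr flip: *)
    finally show "emeasure (distr (uniform_on_unit_sphere V) borel (reflect a)) A
        = emeasure (uniform_on_unit_sphere V) A"
      unfolding uniform_on_unit_sphere_def
      by (simp add: distr_distr emeasure_distr emeasure_uniform_measure comp_def vimage_comp
          measurable_sets[of _ borel borel, simplified])
  qed simp
qed

section \<open>Maximizers of the logistic likelihood\<close>

lemma is_mle_iff: "is_mle n x y b \<longleftrightarrow> (\<forall>c. log_likelihood n x y c \<le> log_likelihood n x y b)"
  by (simp add: is_mle_def is_arg_max_linorder)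

lemma one_plus_exp_pos [simp]: "0 < 1 + exp (t::real)"
  by (simp add: add_pos_pos)

lemma one_plus_exp_neq_0 [simp]: "1 + exp (t::real) \<noteq> 0"
  using one_plus_exp_pos[of t] by linarith

lemma continuous_on_log_likelihood: "continuous_on S (log_likelihood n x y)"
  unfolding log_likelihood_def[abs_def] by (intro continuous_intros) auto

lemma mle_score:
  assumes "is_mle n x y b"
  shows "(\<Sum>i<n. y i / (1 + exp (y i * (x i \<bullet> b))) * (x i \<bullet> v)) = 0"
proof (rule DERIV_local_max)
  let ?g = "\<lambda>s. log_likelihood n x y (b + s *\<^sub>R v)"
  have "((\<lambda>s. - ln (1 + exp (- y i * (x i \<bullet> (b + s *\<^sub>R v)))))
      has_real_derivative y i / (1 + exp (y i * (x i \<bullet> b))) * (x i \<bullet> v)) (at 0)" for i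
    by (rule derivative_eq_intros refl | simp add: inner_add_right)+
      (simp add: exp_minus field_simps)
  then show "(?g has_real_derivative (\<Sum>i<n. y i / (1 + exp (y i * (x i \<bullet> b))) * (x i \<bullet> v))) (at 0)"
    unfolding log_likelihood_def by (intro DERIV_sum)
  \<comment> \<open>The maximum is global, so any radius serves for the neighbourhood.\<close>
  show "(0::real) < 1" by simp
  show "\<forall>s. \<bar>0 - s\<bar> < 1 \<longrightarrow> ?g s \<le> ?g 0" using assms by (simp add: is_mle_iff)
qed

text \<open>The weights \<open>1 / (1 + exp t)\<close> in the score equation strictly decrease in \<open>t\<close>, so the
  difference of the score equations at two maximizers, in the direction between them, is a
  vanishing sum of terms of one sign.\<close>

lemma mle_same_margins:
  assumes b: "is_mle n x y b" and c: "is_mle n x y c" and "i < n"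
  shows "(y i *\<^sub>R x i) \<bullet> (b - c) = 0"
proof -
  define g where "g t u = (1 / (1 + exp u) - 1 / (1 + exp t)) * (t - u)" for t u :: real
  have "g t u = (exp t - exp u) * (t - u) / ((1 + exp u) * (1 + exp t))" for t u
    unfolding g_def by (subst diff_frac_eq) simp_all
  then have g_pos: "0 < g t u" if "t \<noteq> u" for t u
    using that by (cases "t < u") (auto simp: zero_less_mult_iff intro!: divide_pos_pos)
  then have g_nonneg: "0 \<le> g t u" for t u
    by (cases "t = u") (auto simp: g_def less_imp_le)
  have "(\<Sum>i<n. g (y i * (x i \<bullet> b)) (y i * (x i \<bullet> c)))
      = (\<Sum>i<n. y i / (1 + exp (y i * (x i \<bullet> c))) * (x i \<bullet> (b - c)))
        - (\<Sum>i<n. y i / (1 + exp (y i * (x i \<bullet> b))) * (x i \<bullet> (b - c)))"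
    unfolding sum_subtractf[symmetric]
    by (intro sum.cong refl) (simp add: g_def inner_diff_right algebra_simps diff_divide_distrib)
  also have "\<dots> = 0" by (simp only: mle_score[OF b] mle_score[OF c])
  finally have "g (y i * (x i \<bullet> b)) (y i * (x i \<bullet> c)) = 0"
    using g_nonneg \<open>i < n\<close> by (simp add: sum_nonneg_eq_0_iff)
  then have "y i * (x i \<bullet> b) = y i * (x i \<bullet> c)" by (metis g_pos less_irrefl)
  then show ?thesis by (simp add: inner_diff_right algebra_simps)
qed

text \<open>The score equations say that a combination of the vectors
  \<open>y i *\<^sub>R x i\<close> with positive weights vanishes, which expresses
  \<open>x 0\<close> through the others. Equal margins make \<open>b - c\<close> orthogonal to all
  of them, so their span is proper.\<close>

lemma two_mles_imp_span:
  fixes x :: "nat \<Rightarrow> 'a::euclidean_space"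
  assumes b: "is_mle n x y b" and c: "is_mle n x y c" and "b \<noteq> c" and "0 < n" and "y 0 \<noteq> 0"
  shows "x 0 \<in> span ((\<lambda>i. y i *\<^sub>R x i) ` {1..<n})" "span ((\<lambda>i. y i *\<^sub>R x i) ` {1..<n}) \<noteq> UNIV"
proof -
  let ?W = "span ((\<lambda>i. y i *\<^sub>R x i) ` {1..<n})"
  define w where "w i = 1 / (1 + exp (y i * (x i \<bullet> b)))" for i
  have "w 0 > 0" by (simp add: w_def)
  have "(\<Sum>i<n. w i *\<^sub>R y i *\<^sub>R x i) \<bullet> v = 0" for v
    using mle_score[OF b, of v] by (simp add: w_def inner_sum_left)
  then have "(\<Sum>i<n. w i *\<^sub>R y i *\<^sub>R x i) = 0" by (metis inner_eq_zero_iff)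
  moreover have "{..<n} = insert 0 {1..<n}" using \<open>0 < n\<close> by auto
  ultimately have "(w 0 * y 0) *\<^sub>R x 0 = - (\<Sum>i\<in>{1..<n}. w i *\<^sub>R y i *\<^sub>R x i)"
    by (simp add: add_eq_0_iff2)
  also have "\<dots> \<in> ?W" by (intro span_neg span_sum span_scale[of "y i *\<^sub>R x i" for i] span_base) auto
  finally have "inverse (w 0 * y 0) *\<^sub>R (w 0 * y 0) *\<^sub>R x 0 \<in> ?W" by (rule span_scale)
  moreover have "inverse (w 0 * y 0) * (w 0 * y 0) = 1"
    using \<open>w 0 > 0\<close> \<open>y 0 \<noteq> 0\<close> by (intro left_inverse) simp
  ultimately show "x 0 \<in> ?W" by (simp only: scaleR_scaleR scaleR_one)
  have "orthogonal (b - c) u" if "u \<in> (\<lambda>i. y i *\<^sub>R x i) ` {1..<n}" for u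
    using that mle_same_margins[OF b c] by (auto simp: orthogonal_def inner_commute)
  then have "orthogonal (b - c) u" if "u \<in> ?W" for u using that orthogonal_to_span by blast
  then show "?W \<noteq> UNIV" using \<open>b \<noteq> c\<close> by (metis UNIV_I orthogonal_self right_minus_eq)
qed

text \<open>Moving \<open>x 0\<close> orthogonally to \<theta> leaves the likelihood of multiples of
  \<theta> unchanged, so both samples share the maximizer \<open>k *\<^sub>R \<theta>\<close> and
  the same score weights. Subtracting the two score equations in direction \<open>v\<close> leaves
  \<open>s\<close> times a nonzero factor.\<close>

lemma radial_mle_unique_on_line:
  fixes x :: "nat \<Rightarrow> 'a::euclidean_space"
  assumes mle: "is_mle n x y (k *\<^sub>R \<theta>)" and uniq: "\<And>b. is_mle n x y b \<Longrightarrow> b = k *\<^sub>R \<theta>"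
    and mle': "is_mle n (x(0 := x 0 + s *\<^sub>R v)) y (k' *\<^sub>R \<theta>)"
    and v: "v \<bullet> \<theta> = 0" "v \<noteq> 0" and "0 < n" "y 0 \<noteq> 0"
  shows "s = 0"
proof -
  let ?x' = "x(0 := x 0 + s *\<^sub>R v)"
  have inner: "?x' i \<bullet> c *\<^sub>R \<theta> = x i \<bullet> c *\<^sub>R \<theta>" for i c
    using v by (simp add: inner_add_left)
  then have L: "log_likelihood n ?x' y (c *\<^sub>R \<theta>) = log_likelihood n x y (c *\<^sub>R \<theta>)" for c
    by (simp only: log_likelihood_def)
  have "is_mle n x y (k' *\<^sub>R \<theta>)"
    using mle mle' L unfolding is_mle_iff by (metis order_trans)
  then have k': "k' *\<^sub>R \<theta> = k *\<^sub>R \<theta>" by (rule uniq)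
  define w where "w i = y i / (1 + exp (y i * (x i \<bullet> k *\<^sub>R \<theta>)))" for i
  have "w 0 \<noteq> 0" using \<open>y 0 \<noteq> 0\<close> by (simp add: w_def)
  have split: "{..<n} = insert 0 {1..<n}" using \<open>0 < n\<close> by auto
  have "(\<Sum>i<n. w i * (x i \<bullet> v)) = 0" using mle_score[OF mle] by (simp only: w_def)
  then have "w 0 * (x 0 \<bullet> v) + (\<Sum>i\<in>{1..<n}. w i * (x i \<bullet> v)) = 0" by (simp add: split)
  moreover have "(\<Sum>i<n. w i * (?x' i \<bullet> v)) = 0"
    using mle_score[OF mle', of v] unfolding k' inner by (simp only: w_def)
  then have "w 0 * ((x 0 + s *\<^sub>R v) \<bullet> v) + (\<Sum>i\<in>{1..<n}. w i * (x i \<bullet> v)) = 0" by (simp add: split)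
  ultimately have "w 0 * ((x 0 + s *\<^sub>R v) \<bullet> v) = w 0 * (x 0 \<bullet> v)" by linarith
  then show "s = 0" using \<open>w 0 \<noteq> 0\<close> \<open>v \<noteq> 0\<close> by (simp add: inner_add_left)
qed

lemma is_mle_reflect: "is_mle n (\<lambda>i. reflect a (x i)) y b \<longleftrightarrow> is_mle n x y (reflect a b)"
proof -
  have "log_likelihood n (\<lambda>i. reflect a (x i)) y b = log_likelihood n x y (reflect a b)" for b
    by (simp add: log_likelihood_def inner_reflect_left)
  then show ?thesis unfolding is_mle_iff by (metis reflect_reflect)
qed

section \<open>Measurability of events about maximizers\<close>

abbreviation data_space :: "nat \<Rightarrow> (nat \<Rightarrow> 'a::euclidean_space \<times> real) measure" where
  "data_space n \<equiv> \<Pi>\<^sub>M i\<in>{..<n}. borel \<Otimes>\<^sub>M borel"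

abbreviation data_mle :: "nat \<Rightarrow> (nat \<Rightarrow> 'a::euclidean_space \<times> real) \<Rightarrow> 'a \<Rightarrow> bool" where
  "data_mle n d \<equiv> is_mle n (\<lambda>i. fst (d i)) (\<lambda>i. snd (d i))"

text \<open>Asking for existence in \<open>C\<close>, instead of selecting a maximizer, keeps the
  event a function of the data even where maximizers are not unique.\<close>

definition mle_in :: "nat \<Rightarrow> 'a::euclidean_space set \<Rightarrow> (nat \<Rightarrow> 'a \<times> real) set" where
  "mle_in n C = {d \<in> space (data_space n). \<exists>b\<in>C. data_mle n d b}"

lemma measurable_log_likelihood [measurable]:
  "(\<lambda>d. log_likelihood n (\<lambda>i. fst (d i)) (\<lambda>i. snd (d i)) b) \<in> borel_measurable (data_space n)"
  unfolding log_likelihood_def by measurable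

text \<open>On a compact set the likelihood attains its supremum, so that the existence of a maximizer
  there is a countable condition on a dense subset.\<close>

lemma mle_in_compact:
  fixes C :: "'a::euclidean_space set"
  assumes "compact C"
  shows "mle_in n C \<in> sets (data_space n)"
proof (cases "C = {}")
  case False
  obtain D :: "'a set" where D: "countable D" "UNIV \<subseteq> closure D" using separable by metis
  obtain T where T: "countable T" "T \<subseteq> C" "C \<subseteq> closure T" using separable by metis
  \<comment> \<open>\<open>D\<close> supplies the competitors from the whole space and
    \<open>T\<close> the candidates from \<open>C\<close>. The slack
    \<open>inverse (real (Suc m))\<close> is there because the maximizer itself may be missing from
    \<open>T\<close>.\<close>
  have "(\<exists>c\<in>C. is_mle n x y c) \<longleftrightarrow>
      (\<forall>b\<in>D. \<forall>m. \<exists>c\<in>T. log_likelihood n x y b < log_likelihood n x y c + inverse (real (Suc m)))"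
    (is "?L \<longleftrightarrow> ?R") for x :: "nat \<Rightarrow> 'a" and y
  proof
    let ?l = "log_likelihood n x y"
    assume ?L
    then obtain c where c: "c \<in> C" "\<And>b. ?l b \<le> ?l c" by (auto simp: is_mle_iff)
    show ?R
    proof (intro ballI allI)
      fix b m assume "b \<in> D"
      have "c \<in> closure T" using c T by blast
      moreover have "isCont ?l c"
        using continuous_on_log_likelihood[of UNIV n x y] by (simp add: continuous_on_eq_continuous_at)
      then obtain d where "d > 0" "\<And>t. dist t c < d \<Longrightarrow> dist (?l t) (?l c) < inverse (real (Suc m))"
        unfolding continuous_at_eps_delta by (metis inverse_positive_iff_positive of_nat_0_less_iff zero_less_Suc)
      ultimately obtain t where "t \<in> T" "dist (?l t) (?l c) < inverse (real (Suc m))"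
        by (meson closure_approachable)
      then show "\<exists>c\<in>T. ?l b < ?l c + inverse (real (Suc m))"
        using c(2)[of b] by (intro bexI[of _ t]) (auto simp: dist_real_def abs_if split: if_splits)
    qed
  next
    let ?l = "log_likelihood n x y"
    assume R: ?R
    obtain c where c: "c \<in> C" "\<And>t. t \<in> C \<Longrightarrow> ?l t \<le> ?l c"
      using continuous_attains_sup[OF assms False continuous_on_log_likelihood] by blast
    have "?l b \<le> ?l c" if "b \<in> D" for b
    proof (rule field_le_epsilon)
      fix e :: real assume "0 < e"
      then obtain m where "inverse (real (Suc m)) < e" using reals_Archimedean by blast
      moreover obtain t where "t \<in> T" "?l b < ?l t + inverse (real (Suc m))" using R \<open>b \<in> D\<close> by (meson bspec)
      ultimately show "?l b \<le> ?l c + e" using c(2)[of t] T(2) by force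
    qed
    then have "?l b \<le> ?l c" for b
      using continuous_le_on_closure[OF continuous_on_log_likelihood, of b D] D(2) by blast
    then show ?L using c(1) by (auto simp: is_mle_iff)
  qed
  then have "mle_in n C = {d \<in> space (data_space n). \<forall>b\<in>D. \<forall>m. \<exists>c\<in>T.
      log_likelihood n (\<lambda>i. fst (d i)) (\<lambda>i. snd (d i)) b
        < log_likelihood n (\<lambda>i. fst (d i)) (\<lambda>i. snd (d i)) c + inverse (real (Suc m))}"
    by (simp add: mle_in_def)
  also have "\<dots> \<in> sets (data_space n)"
    by (intro sets.sets_Collect_countable_All' sets.sets_Collect_countable_All
        sets.sets_Collect_countable_Ex' D T) measurable
  finally show ?thesis .
qed (simp add: mle_in_def)

lemma mle_in_UN: "mle_in n (\<Union>k. C k) = (\<Union>k. mle_in n (C k))"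
  by (auto simp: mle_in_def)

lemma mle_in_open [measurable]: "open C \<Longrightarrow> mle_in n C \<in> sets (data_space n)"
proof -
  assume "open C"
  then obtain K where K: "\<And>k::nat. compact (K k)" "\<Union>(range K) = C"
    using open_Union_compact_subsets by metis
  have "mle_in n (\<Union>k. K k) \<in> sets (data_space n)"
    unfolding mle_in_UN using mle_in_compact[OF K(1)] by blast
  then show ?thesis by (simp add: K(2))
qed

lemma mle_in_closed [measurable]: "closed C \<Longrightarrow> mle_in n C \<in> sets (data_space n)"
proof -
  assume C: "closed C"
  have "(\<Union>k. C \<inter> cball 0 (real k)) = C"
    using real_arch_simple by auto
  moreover have "mle_in n (\<Union>k. C \<inter> cball 0 (real k)) \<in> sets (data_space n)"
    unfolding mle_in_UN using mle_in_compact[OF closed_Int_compact[OF C compact_cball]] by blast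
  ultimately show ?thesis by simp
qed

definition many_mles :: "nat \<Rightarrow> (nat \<Rightarrow> 'a::euclidean_space \<times> real) set" where
  "many_mles n = {d \<in> space (data_space n). \<exists>b c. b \<noteq> c \<and> data_mle n d b \<and> data_mle n d c}"

text \<open>Two distinct maximizers are separated by a rational value of some coordinate, hence lie
  in two opposite open half-spaces from a countable family.\<close>

lemma many_mles_measurable [measurable]:
  "(many_mles n :: (nat \<Rightarrow> 'a::euclidean_space \<times> real) set) \<in> sets (data_space n)"
proof -
  let ?H = "\<lambda>i q. mle_in n {b::'a. b \<bullet> i < of_rat q} \<inter> mle_in n {b. of_rat q < b \<bullet> i}"
  have "many_mles n = (\<Union>i\<in>Basis. \<Union>q::rat. ?H i q)"
  proof (intro equalityI subsetI)
    fix d :: "nat \<Rightarrow> 'a \<times> real" assume "d \<in> many_mles n"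
    then obtain b c where bc: "b \<noteq> c" "data_mle n d b" "data_mle n d c" and d: "d \<in> space (data_space n)"
      unfolding many_mles_def by blast
    then obtain i where i: "i \<in> Basis" "b \<bullet> i \<noteq> c \<bullet> i" using euclidean_eqI by blast
    obtain b' c' where bc': "b' \<bullet> i < c' \<bullet> i" "data_mle n d b'" "data_mle n d c'"
      using bc i(2) by (metis linorder_neqE_linordered_idom)
    then obtain q where "b' \<bullet> i < of_rat q" "of_rat q < c' \<bullet> i" using of_rat_dense by blast
    with bc' d have "d \<in> ?H i q" by (auto simp: mle_in_def)
    with i(1) show "d \<in> (\<Union>i\<in>Basis. \<Union>q. ?H i q)" by blast
  next
    fix d :: "nat \<Rightarrow> 'a \<times> real" assume "d \<in> (\<Union>i\<in>Basis. \<Union>q. ?H i q)"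
    then obtain i b c and q :: rat where "d \<in> space (data_space n)" "data_mle n d b" "data_mle n d c"
      "b \<bullet> i < of_rat q" "of_rat q < c \<bullet> i"
      by (auto simp: mle_in_def)
    moreover from this have "b \<noteq> c" by auto
    ultimately show "d \<in> many_mles n" unfolding many_mles_def by blast
  qed
  also have "\<dots> \<in> sets (data_space n)"
    by (rule sets.finite_UN, simp, rule sets.countable_UN'', simp, rule sets.Int)
      (intro mle_in_open open_halfspace_component_lt open_halfspace_component_gt)+
  finally show ?thesis .
qed

lemma is_mle_cong:
  assumes "\<And>i. i < n \<Longrightarrow> x i = x' i" "\<And>i. i < n \<Longrightarrow> y i = y' i"
  shows "is_mle n x y b \<longleftrightarrow> is_mle n x' y' b"
proof -
  have "log_likelihood n x y = log_likelihood n x' y'"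
    using assms by (intro ext) (simp add: log_likelihood_def)
  then show ?thesis by (simp add: is_mle_iff)
qed

section \<open>The law of the data\<close>

text \<open>All translates of \<open>A\<close> along \<open>v\<close> have the measure of
  \<open>A\<close>, so averaging over the shifts in \<open>{0..1}\<close> returns that measure. With
  the integrals exchanged, the inner one runs over at most one shift and vanishes.\<close>

lemma null_set_if_lines_meet_once:
  fixes A :: "'a::euclidean_space set"
  assumes [measurable]: "A \<in> sets borel" and lines: "\<And>x s t. x + s *\<^sub>R v \<in> A \<Longrightarrow> x + t *\<^sub>R v \<in> A \<Longrightarrow> s = t"
  shows "A \<in> null_sets lborel"
proof -
  have shift: "(\<integral>\<^sup>+x. indicator A (x + s *\<^sub>R v) \<partial>lborel) = emeasure lborel A" for s
  proof -
    have "(\<integral>\<^sup>+x. indicator A (x + s *\<^sub>R v) \<partial>lborel)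
        = (\<integral>\<^sup>+x. indicator A x \<partial>distr lborel borel ((+) (s *\<^sub>R v)))"
      by (subst nn_integral_distr) (simp_all add: add.commute)
    then show ?thesis by (simp add: lborel_distr_plus)
  qed
  have "emeasure lborel A = (\<integral>\<^sup>+s. emeasure lborel A * indicator {0..1::real} s \<partial>lborel)"
    by (subst nn_integral_cmult_indicator) simp_all
  also have "\<dots> = (\<integral>\<^sup>+s. \<integral>\<^sup>+x. indicator {0..1} s * indicator A (x + s *\<^sub>R v) \<partial>lborel \<partial>lborel)"
    by (subst nn_integral_cmult) (simp_all add: shift mult.commute)
  also have "\<dots> = (\<integral>\<^sup>+x. \<integral>\<^sup>+s. indicator {0..1} s * indicator A (x + s *\<^sub>R v) \<partial>lborel \<partial>lborel)"
    by (rule lborel_pair.Fubini') measurable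
  also have "\<dots> = (\<integral>\<^sup>+x. 0 \<partial>(lborel :: 'a measure))"
  proof (intro nn_integral_cong)
    fix x
    have "{s. x + s *\<^sub>R v \<in> A} \<subseteq> {SOME s. x + s *\<^sub>R v \<in> A}"
      using lines by (auto intro: someI2)
    then have "AE s in lborel. s \<notin> {s. x + s *\<^sub>R v \<in> A}"
      using countable_subset by (intro AE_not_in countable_imp_null_set_lborel) blast
    then have "(\<integral>\<^sup>+s. indicator {0..1} s * indicator A (x + s *\<^sub>R v) \<partial>lborel) = (\<integral>\<^sup>+s. 0 \<partial>(lborel :: real measure))"
      by - (rule nn_integral_cong_AE, auto elim!: eventually_mono)
    then show "(\<integral>\<^sup>+s. indicator {0..1} s * indicator A (x + s *\<^sub>R v) \<partial>lborel) = 0" by simp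
  qed
  finally show ?thesis by (simp add: null_sets_def)
qed

text \<open>Two points of \<open>W\<close> on a line in a direction \<open>v\<close> outside
  \<open>W\<close> would put \<open>v\<close> into \<open>W\<close>.\<close>

lemma null_set_proper_subspace:
  fixes W :: "'a::euclidean_space set"
  assumes "subspace W" "W \<noteq> UNIV" "A \<subseteq> W" "A \<in> sets borel"
  shows "A \<in> null_sets lborel"
proof -
  obtain v where v: "v \<notin> W" using \<open>W \<noteq> UNIV\<close> by blast
  show ?thesis
  proof (rule null_set_if_lines_meet_once)
    fix x s t assume "x + s *\<^sub>R v \<in> A" "x + t *\<^sub>R v \<in> A"
    then have "inverse (s - t) *\<^sub>R ((x + s *\<^sub>R v) - (x + t *\<^sub>R v)) \<in> W"
      using assms(1,3) by (blast intro: subspace_scale subspace_diff)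
    moreover have "inverse (s - t) *\<^sub>R ((x + s *\<^sub>R v) - (x + t *\<^sub>R v)) = v" if "s \<noteq> t"
      using that by (simp flip: scaleR_left_diff_distrib)
    ultimately show "s = t" using v by metis
  qed fact
qed

lemma vimage_reflect: "reflect a -` C = reflect a ` C"
proof (intro set_eqI iffI)
  fix x assume "x \<in> reflect a -` C"
  then show "x \<in> reflect a ` C" by (metis image_eqI reflect_reflect vimageD)
qed auto

locale logistic_sample = prob_space M
  for M :: "'w measure" and n :: nat and \<theta> :: "'a::euclidean_space"
    and X :: "nat \<Rightarrow> 'w \<Rightarrow> 'a" and Y :: "nat \<Rightarrow> 'w \<Rightarrow> real" +
  assumes n_pos: "0 < n" and model: "logistic_model M n \<theta> X Y"
begin

lemma indep: "indep_vars (\<lambda>_. borel \<Otimes>\<^sub>M borel) (\<lambda>i \<omega>. (X i \<omega>, Y i \<omega>)) {..<n}"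
  and gauss: "i < n \<Longrightarrow> distributed M lborel (X i) (\<lambda>x. ennreal (std_gaussian_density x))"
  and labels: "i < n \<Longrightarrow> \<omega> \<in> space M \<Longrightarrow> Y i \<omega> \<in> {-1, 1}"
  and cond_prob: "i < n \<Longrightarrow> AE \<omega> in M. real_cond_exp M (vimage_algebra (space M) (X i) borel)
      (indicator {\<omega> \<in> space M. Y i \<omega> = 1}) \<omega> = 1 / (1 + exp (- (X i \<omega> \<bullet> \<theta>)))"
  using model by (auto simp: logistic_model_def)

lemma XY_measurable:
  "i < n \<Longrightarrow> (\<lambda>\<omega>. (X i \<omega>, Y i \<omega>)) \<in> M \<rightarrow>\<^sub>M borel \<Otimes>\<^sub>M borel"
  using indep by (simp add: indep_vars_def)

lemma X_measurable: "i < n \<Longrightarrow> X i \<in> borel_measurable M"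
  using measurable_compose[OF XY_measurable measurable_fst] by simp

lemma Y_measurable: "i < n \<Longrightarrow> Y i \<in> borel_measurable M"
  using measurable_compose[OF XY_measurable measurable_snd] by simp

definition data :: "'w \<Rightarrow> nat \<Rightarrow> 'a \<times> real" where
  "data \<omega> = (\<lambda>i\<in>{..<n}. (X i \<omega>, Y i \<omega>))"

lemma data_measurable [measurable]: "data \<in> M \<rightarrow>\<^sub>M data_space n"
  unfolding data_def[abs_def] by (intro measurable_restrict XY_measurable) simp

lemma data_mle_data: "data_mle n (data \<omega>) b \<longleftrightarrow> is_mle n (\<lambda>i. X i \<omega>) (\<lambda>i. Y i \<omega>) b"
  by (rule is_mle_cong) (simp_all add: data_def)

abbreviation obs_law :: "nat \<Rightarrow> ('a \<times> real) measure" where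
  "obs_law i \<equiv> distr M (borel \<Otimes>\<^sub>M borel) (\<lambda>\<omega>. (X i \<omega>, Y i \<omega>))"

lemma distr_data: "distr M (data_space n) data = (\<Pi>\<^sub>M i\<in>{..<n}. obs_law i)"
  using indep n_pos XY_measurable unfolding data_def[abs_def]
  by (subst (asm) indep_vars_iff_distr_eq_PiM') auto

section \<open>Almost sure uniqueness of the maximizer and nonvanishing of its component orthogonal
  to \<theta>\<close>

lemma AE_X_notin:
  assumes "i < n" "A \<in> null_sets lborel"
  shows "AE \<omega> in M. X i \<omega> \<notin> A"
proof -
  have A: "A \<in> sets lborel" "AE x in lborel. x \<notin> A" using assms(2) AE_not_in by blast+
  have "emeasure M (X i -` A \<inter> space M) = (\<integral>\<^sup>+x. ennreal (std_gaussian_density x) * indicator A x \<partial>lborel)"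
    using gauss[OF assms(1)] A(1) by (rule distributed_emeasure)
  also have "\<dots> = (\<integral>\<^sup>+x. 0 \<partial>(lborel :: 'a measure))"
    using A(2) by (intro nn_integral_cong_AE) (auto elim!: eventually_mono)
  finally have "X i -` A \<inter> space M \<in> null_sets M"
    using measurable_sets[OF X_measurable[OF assms(1)], of A] A(1) by (simp add: null_sets_def)
  from AE_not_in[OF this] show ?thesis by (auto elim!: eventually_mono)
qed

text \<open>With two labels, \<open>S\<close> can be hit only through its slices at
  \<open>-1\<close> and \<open>1\<close>. These are Borel sets, which is why \<open>null\<close> may
  presuppose it.\<close>

lemma obs_law_null:
  assumes "i < n" and S: "S \<in> sets (borel \<Otimes>\<^sub>M borel)"
    and null: "\<And>y. y \<in> {-1, 1} \<Longrightarrow> {x. (x, y) \<in> S} \<in> sets borel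
      \<Longrightarrow> {x. (x, y) \<in> S} \<in> null_sets lborel"
  shows "emeasure (obs_law i) S = 0"
proof -
  have slice: "{x. (x, y) \<in> S} \<in> sets borel" for y
    using sets_Pair2[OF S, of y] by (simp add: vimage_def)
  have "AE \<omega> in M. X i \<omega> \<notin> {x. (x, -1) \<in> S}" "AE \<omega> in M. X i \<omega> \<notin> {x. (x, 1) \<in> S}"
    by (rule AE_X_notin[OF assms(1) null]; simp add: slice)+
  then have "AE \<omega> in M. (X i \<omega>, Y i \<omega>) \<notin> S"
    using AE_space
  proof eventually_elim
    case (elim \<omega>)
    with labels[OF assms(1)] show ?case by force
  qed
  then have "AE z in obs_law i. z \<notin> S"
    using XY_measurable[OF assms(1)] S by (subst AE_distr_iff) auto
  then show ?thesis using S AE_iff_null_sets[of S "obs_law i"] by (simp add: null_setsD1)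
qed

text \<open>By independence, observation \<open>0\<close> can be integrated out first with all
  others frozen in \<open>d\<close>; each fibre is then handled by the law of a single
  observation.\<close>

lemma AE_data_notin:
  assumes B: "B \<in> sets (data_space n)"
    and null: "\<And>d y. y \<in> {-1, 1} \<Longrightarrow> {x. d(0 := (x, y)) \<in> B} \<in> sets borel
      \<Longrightarrow> {x. d(0 := (x, y)) \<in> B} \<in> null_sets lborel"
  shows "AE \<omega> in M. data \<omega> \<notin> B"
proof -
  let ?R = "\<Pi>\<^sub>M i\<in>{1..<n}. obs_law i"
  have split: "{..<n} = insert 0 {1..<n}" using n_pos by auto
  have prob: "prob_space (obs_law i)" if "i < n" for i
    using XY_measurable[OF that] by (rule prob_space_distr)
  interpret O: prob_space "obs_law 0" using prob n_pos by simp
  interpret R: prob_space ?R by (rule prob_space_PiM) (use prob in auto)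
  interpret OR: pair_sigma_finite "obs_law 0" ?R ..
  let ?f = "\<lambda>(z, d). d(0 := z)"
  have law: "distr (obs_law 0 \<Otimes>\<^sub>M ?R) (\<Pi>\<^sub>M i\<in>{..<n}. obs_law i) ?f = (\<Pi>\<^sub>M i\<in>{..<n}. obs_law i)"
    unfolding split by (rule distr_pair_PiM_eq_PiM) (use prob n_pos in auto)
  have sets: "sets (\<Pi>\<^sub>M i\<in>{..<n}. obs_law i) = sets (data_space n)"
    by (intro sets_PiM_cong) auto
  have f [measurable]: "?f \<in> obs_law 0 \<Otimes>\<^sub>M ?R \<rightarrow>\<^sub>M (\<Pi>\<^sub>M i\<in>{..<n}. obs_law i)"
    unfolding split by measurable
  let ?C = "?f -` B \<inter> space (obs_law 0 \<Otimes>\<^sub>M ?R)"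
  have C: "?C \<in> sets (obs_law 0 \<Otimes>\<^sub>M ?R)"
    using B sets by (intro measurable_sets[OF f]) simp
  have "emeasure (distr M (data_space n) data) B = emeasure (obs_law 0 \<Otimes>\<^sub>M ?R) ?C"
    unfolding distr_data by (subst law[symmetric], subst emeasure_distr) (use B f in \<open>auto simp: sets\<close>)
  also have "\<dots> = (\<integral>\<^sup>+d. emeasure (obs_law 0) ((\<lambda>z. (z, d)) -` ?C) \<partial>?R)"
    using C by (rule OR.emeasure_pair_measure_alt2)
  also have "\<dots> = (\<integral>\<^sup>+d. 0 \<partial>?R)"
  proof (intro nn_integral_cong)
    fix d assume d: "d \<in> space ?R"
    have "(\<lambda>z. (z, d)) -` ?C = {z. d(0 := z) \<in> B}"
      using d by (auto simp: space_pair_measure)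
    moreover have "(\<lambda>z. (z, d)) -` ?C \<in> sets (obs_law 0)" using C by (rule sets_Pair2)
    ultimately show "emeasure (obs_law 0) ((\<lambda>z. (z, d)) -` ?C) = 0"
      using null[of _ d] n_pos by (intro obs_law_null) auto
  qed
  finally have "emeasure M (data -` B \<inter> space M) = 0"
    using B by (simp add: emeasure_distr)
  then have "data -` B \<inter> space M \<in> null_sets M"
    using B by (auto simp: null_sets_def)
  from AE_not_in[OF this] show ?thesis by (auto elim!: eventually_mono)
qed

text \<open>The two exceptional sets meet every fibre over \<open>(x\<^sub>1, \<dots>, x\<^bsub>n-1\<^esub>, y)\<close> in a null set of values of \<open>x\<^sub>0\<close>:
  two maximizers force \<open>x\<^sub>0\<close> into a proper subspace spanned by the other covariates, and a maximizer
  parallel to \<open>\<theta>\<close> fixes the position of \<open>x\<^sub>0\<close> on each line orthogonal to \<open>\<theta>\<close>.\<close>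

lemma AE_not_many_mles: "AE \<omega> in M. data \<omega> \<notin> many_mles n"
proof (rule AE_data_notin[OF many_mles_measurable])
  fix d :: "nat \<Rightarrow> 'a \<times> real" and y :: real assume "y \<in> {-1, 1}"
  let ?A = "{x. d(0 := (x, y)) \<in> many_mles n}"
  assume "?A \<in> sets borel"
  let ?W = "span ((\<lambda>i. snd (d i) *\<^sub>R fst (d i)) ` {1..<n})"
  have *: "x \<in> ?W \<and> ?W \<noteq> UNIV" if x: "x \<in> ?A" for x
  proof -
    let ?d = "d(0 := (x, y))"
    obtain b c where "b \<noteq> c" "data_mle n ?d b" "data_mle n ?d c"
      using x unfolding many_mles_def by blast
    then have "fst (?d 0) \<in> span ((\<lambda>i. snd (?d i) *\<^sub>R fst (?d i)) ` {1..<n})"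
      "span ((\<lambda>i. snd (?d i) *\<^sub>R fst (?d i)) ` {1..<n}) \<noteq> UNIV"
      using n_pos \<open>y \<in> {-1, 1}\<close> two_mles_imp_span[of n "\<lambda>i. fst (?d i)" "\<lambda>i. snd (?d i)" b c]
      by auto
    moreover have "(\<lambda>i. snd (?d i) *\<^sub>R fst (?d i)) ` {1..<n} = (\<lambda>i. snd (d i) *\<^sub>R fst (d i)) ` {1..<n}"
      by (intro image_cong) auto
    ultimately show ?thesis by simp
  qed
  show "?A \<in> null_sets lborel"
  proof (cases "?A = {}")
    case False
    then have "?W \<noteq> UNIV" "?A \<subseteq> ?W" using * by blast+
    then show ?thesis using \<open>?A \<in> sets borel\<close> by (intro null_set_proper_subspace[OF subspace_span])
  qed simp
qed

lemma AE_mle_not_radial: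
  assumes v: "v \<bullet> \<theta> = 0" "v \<noteq> 0"
  shows "AE \<omega> in M. data \<omega> \<notin> mle_in n (span {\<theta>}) - many_mles n"
proof (rule AE_data_notin)
  show "mle_in n (span {\<theta>}) - many_mles n \<in> sets (data_space n)"
    by (intro sets.Diff mle_in_closed closed_subspace subspace_span many_mles_measurable)
next
  fix d :: "nat \<Rightarrow> 'a \<times> real" and y :: real assume y: "y \<in> {-1, 1}"
  let ?A = "{x. d(0 := (x, y)) \<in> mle_in n (span {\<theta>}) - many_mles n}"
  assume A: "?A \<in> sets borel"
  show "?A \<in> null_sets lborel"
  proof (rule null_set_if_lines_meet_once[OF A])
    fix x s t assume s: "x + s *\<^sub>R v \<in> ?A" and t: "x + t *\<^sub>R v \<in> ?A"
    let ?x = "\<lambda>s i. fst ((d(0 := (x + s *\<^sub>R v, y))) i)" and ?y = "\<lambda>i. snd ((d(0 := (x, y))) i)"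
    have y_upd: "(\<lambda>i. snd ((d(0 := (x + s *\<^sub>R v, y))) i)) = ?y" for s by auto
    have x_upd: "?x s = (?x t)(0 := ?x t 0 + (s - t) *\<^sub>R v)" for s t
      by (auto simp: fun_eq_iff algebra_simps)
    have radial: "\<exists>k. is_mle n (?x s) ?y (k *\<^sub>R \<theta>)" if "x + s *\<^sub>R v \<in> ?A" for s
    proof -
      have "\<exists>b\<in>span {\<theta>}. data_mle n (d(0 := (x + s *\<^sub>R v, y))) b"
        using that by (simp add: mle_in_def)
      then show ?thesis unfolding y_upd span_singleton by blast
    qed
    obtain k where k: "is_mle n (?x s) ?y (k *\<^sub>R \<theta>)" using radial[OF s] ..
    obtain l where l: "is_mle n (?x t) ?y (l *\<^sub>R \<theta>)" using radial[OF t] ..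
    \<comment> \<open>Removing \<open>many_mles n\<close> provides the uniqueness that the line
      argument requires.\<close>
    have "d(0 := (x + t *\<^sub>R v, y)) \<in> space (data_space n)" "d(0 := (x + t *\<^sub>R v, y)) \<notin> many_mles n"
      using t by (simp_all add: mle_in_def)
    then have "b = l *\<^sub>R \<theta>" if "is_mle n (?x t) ?y b" for b
      using l that unfolding many_mles_def mem_Collect_eq y_upd by blast
    from radial_mle_unique_on_line[OF l this _ v n_pos, of "s - t" k] k y
    have "s - t = 0" unfolding x_upd[of s t] by auto
    then show "s = t" by simp
  qed
qed

section \<open>Invariance of the law of the data under reflections fixing \<theta>\<close>

lemma distr_X_reflect:
  assumes "i < n"
  shows "distr M borel (\<lambda>\<omega>. reflect a (X i \<omega>)) = distr M borel (X i)"
proof (rule measure_eqI)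
  note [measurable] = X_measurable[OF assms]
  fix A assume "A \<in> sets (distr M borel (\<lambda>\<omega>. reflect a (X i \<omega>)))"
  then have A [measurable]: "A \<in> sets borel" by simp
  have [measurable]: "reflect a -` A \<in> sets borel"
    using measurable_sets[OF measurable_reflect A, of a] by simp
  have density_measurable [measurable]: "(std_gaussian_density :: 'a \<Rightarrow> real) \<in> borel_measurable borel"
    unfolding std_gaussian_density_def[abs_def] by measurable
  have law: "emeasure M (X i -` B \<inter> space M) = (\<integral>\<^sup>+x. ennreal (std_gaussian_density x) * indicator B x \<partial>lborel)"
    if "B \<in> sets borel" for B
    using gauss[OF assms] that by (intro distributed_emeasure) auto
  have "emeasure M (X i -` (reflect a -` A) \<inter> space M)
      = (\<integral>\<^sup>+x. ennreal (std_gaussian_density (reflect a x)) * indicator A (reflect a x) \<partial>lborel)"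
    by (subst law) (auto simp: std_gaussian_density_def indicator_def intro!: nn_integral_cong)
  also have "\<dots> = (\<integral>\<^sup>+x. ennreal (std_gaussian_density x) * indicator A x \<partial>distr lborel borel (reflect a))"
    by (subst nn_integral_distr) simp_all
  also have "\<dots> = emeasure M (X i -` A \<inter> space M)"
    by (simp add: distr_lborel_reflect law)
  finally show "emeasure (distr M borel (\<lambda>\<omega>. reflect a (X i \<omega>))) A = emeasure (distr M borel (X i)) A"
    by (simp add: emeasure_distr vimage_def)
qed simp

text \<open>The defining property of the conditional expectation, integrated over the event that
  \<open>X i\<close> lies in \<open>A\<close> and transported to the law of
  \<open>X i\<close>.\<close>

lemma prob_label_1:
  assumes "i < n" and A: "A \<in> sets borel"
  shows "prob {\<omega> \<in> space M. X i \<omega> \<in> A \<and> Y i \<omega> = 1}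
    = (\<integral>x. indicator A x * (1 / (1 + exp (- (x \<bullet> \<theta>)))) \<partial>distr M borel (X i))"
proof -
  note [measurable] = X_measurable[OF assms(1)] Y_measurable[OF assms(1)] A
  let ?F = "vimage_algebra (space M) (X i) borel" and ?I = "indicator {\<omega> \<in> space M. Y i \<omega> = 1} :: 'w \<Rightarrow> real"
  let ?A = "X i -` A \<inter> space M"
  have "subalgebra M ?F"
    unfolding subalgebra_def using X_measurable[OF assms(1)]
    by (auto simp: sets_vimage_algebra2 measurable_sets)
  then interpret F: finite_measure_subalgebra M ?F by unfold_locales
  have "prob {\<omega> \<in> space M. X i \<omega> \<in> A \<and> Y i \<omega> = 1} = (\<integral>\<omega>. indicator {\<omega> \<in> space M. X i \<omega> \<in> A \<and> Y i \<omega> = 1} \<omega> \<partial>M)"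
    by (simp add: Int_absorb2 subset_eq)
  also have "\<dots> = (\<integral>\<omega>\<in>?A. ?I \<omega> \<partial>M)"
    unfolding set_lebesgue_integral_def
    by (intro Bochner_Integration.integral_cong) (auto simp: indicator_def)
  also have "\<dots> = (\<integral>\<omega>\<in>?A. real_cond_exp M ?F ?I \<omega> \<partial>M)"
    by (intro F.real_cond_exp_intA in_vimage_algebra A integrable_real_indicator)
      (simp_all add: emeasure_eq_measure)
  also have "\<dots> = (\<integral>\<omega>. indicator A (X i \<omega>) * (1 / (1 + exp (- (X i \<omega> \<bullet> \<theta>)))) \<partial>M)"
    unfolding set_lebesgue_integral_def
  proof (rule integral_cong_AE)
    show "AE \<omega> in M. indicat_real ?A \<omega> *\<^sub>R real_cond_exp M ?F ?I \<omega>
        = indicator A (X i \<omega>) * (1 / (1 + exp (- (X i \<omega> \<bullet> \<theta>))))"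
      using cond_prob[OF assms(1)] AE_space by eventually_elim (auto simp: indicator_def)
  qed measurable
  also have "\<dots> = (\<integral>x. indicator A x * (1 / (1 + exp (- (x \<bullet> \<theta>)))) \<partial>distr M borel (X i))"
    by (subst integral_distr) simp_all
  finally show ?thesis .
qed

text \<open>The label probability sees \<open>x\<close> only through
  \<open>x \<bullet> \<theta>\<close>, which the reflection preserves. The label \<open>-1\<close>
  follows by complement.\<close>

lemma prob_label_reflect:
  assumes "i < n" "a \<bullet> \<theta> = 0" and A: "A \<in> sets borel" and y: "y \<in> {-1, 1}"
  shows "prob {\<omega> \<in> space M. reflect a (X i \<omega>) \<in> A \<and> Y i \<omega> = y}
    = prob {\<omega> \<in> space M. X i \<omega> \<in> A \<and> Y i \<omega> = y}"
proof -
  note [measurable] = X_measurable[OF assms(1)] Y_measurable[OF assms(1)] A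
  let ?L = "distr M borel (X i)"
  have RA [measurable]: "reflect a -` A \<in> sets borel"
    using measurable_sets[OF measurable_reflect A, of a] by simp
  have L: "distr ?L borel (reflect a) = ?L"
    using distr_X_reflect[OF assms(1), of a] by (simp add: distr_distr comp_def)
  have "reflect a x \<bullet> \<theta> = x \<bullet> \<theta>" for x
    by (simp add: inner_reflect_left reflect_fixes assms(2))
  then have "prob {\<omega> \<in> space M. X i \<omega> \<in> reflect a -` A \<and> Y i \<omega> = 1}
      = (\<integral>x. indicator A (reflect a x) * (1 / (1 + exp (- (reflect a x \<bullet> \<theta>)))) \<partial>?L)"
    unfolding prob_label_1[OF assms(1) RA] by (simp add: indicator_def)
  also have "\<dots> = (\<integral>x. indicator A x * (1 / (1 + exp (- (x \<bullet> \<theta>)))) \<partial>distr ?L borel (reflect a))"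
    by (subst integral_distr) simp_all
  also have "\<dots> = prob {\<omega> \<in> space M. X i \<omega> \<in> A \<and> Y i \<omega> = 1}"
    by (simp only: L prob_label_1[OF assms(1) A])
  finally have 1: "prob {\<omega> \<in> space M. reflect a (X i \<omega>) \<in> A \<and> Y i \<omega> = 1}
      = prob {\<omega> \<in> space M. X i \<omega> \<in> A \<and> Y i \<omega> = 1}" by simp
  have "measure (distr M borel (\<lambda>\<omega>. reflect a (X i \<omega>))) A = measure ?L A"
    by (simp only: distr_X_reflect[OF assms(1)])
  then have all: "prob {\<omega> \<in> space M. reflect a (X i \<omega>) \<in> A} = prob {\<omega> \<in> space M. X i \<omega> \<in> A}"
    by (simp add: measure_distr vimage_def Int_def conj_commute)
  have neg: "prob {\<omega> \<in> space M. Z \<omega> \<in> A \<and> Y i \<omega> = -1}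
      = prob {\<omega> \<in> space M. Z \<omega> \<in> A} - prob {\<omega> \<in> space M. Z \<omega> \<in> A \<and> Y i \<omega> = 1}"
    if [measurable]: "Z \<in> borel_measurable M" for Z
  proof -
    have "{\<omega> \<in> space M. Z \<omega> \<in> A \<and> Y i \<omega> = -1}
        = {\<omega> \<in> space M. Z \<omega> \<in> A} - {\<omega> \<in> space M. Z \<omega> \<in> A \<and> Y i \<omega> = 1}"
      using labels[OF assms(1)] by auto
    then show ?thesis by (simp only:) (intro finite_measure_Diff; auto)
  qed
  show ?thesis using y 1 neg[of "\<lambda>\<omega>. reflect a (X i \<omega>)"] neg[of "X i"] all by auto
qed

lemma obs_law_reflect:
  assumes "i < n" "a \<bullet> \<theta> = 0"
  shows "distr M (borel \<Otimes>\<^sub>M borel) (\<lambda>\<omega>. (reflect a (X i \<omega>), Y i \<omega>)) = obs_law i"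
proof (rule measure_eqI)
  note [measurable] = X_measurable[OF assms(1)] Y_measurable[OF assms(1)]
  fix S :: "('a \<times> real) set"
  assume "S \<in> sets (distr M (borel \<Otimes>\<^sub>M borel) (\<lambda>\<omega>. (reflect a (X i \<omega>), Y i \<omega>)))"
  then have S [measurable]: "S \<in> sets (borel \<Otimes>\<^sub>M borel)" by simp
  define A where "A y = {x. (x, y) \<in> S}" for y
  have A [measurable]: "A y \<in> sets borel" for y
    using sets_Pair2[OF S, of y] by (simp add: A_def vimage_def)
  have split: "prob {\<omega> \<in> space M. (Z \<omega>, Y i \<omega>) \<in> S}
      = prob {\<omega> \<in> space M. Z \<omega> \<in> A (-1) \<and> Y i \<omega> = -1} + prob {\<omega> \<in> space M. Z \<omega> \<in> A 1 \<and> Y i \<omega> = 1}"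
    if [measurable]: "Z \<in> borel_measurable M" for Z
  proof -
    have "{\<omega> \<in> space M. (Z \<omega>, Y i \<omega>) \<in> S}
        = {\<omega> \<in> space M. Z \<omega> \<in> A (-1) \<and> Y i \<omega> = -1} \<union> {\<omega> \<in> space M. Z \<omega> \<in> A 1 \<and> Y i \<omega> = 1}"
      using labels[OF assms(1)] by (fastforce simp: A_def)
    then show ?thesis by (simp only:) (intro finite_measure_Union; auto)
  qed
  have "prob {\<omega> \<in> space M. (reflect a (X i \<omega>), Y i \<omega>) \<in> S} = prob {\<omega> \<in> space M. (X i \<omega>, Y i \<omega>) \<in> S}"
    using prob_label_reflect[OF assms A] by (simp add: split)
  then show "emeasure (distr M (borel \<Otimes>\<^sub>M borel) (\<lambda>\<omega>. (reflect a (X i \<omega>), Y i \<omega>))) S = emeasure (obs_law i) S"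
    by (simp add: emeasure_distr emeasure_eq_measure vimage_def Int_def conj_commute)
qed simp

text \<open>The reflected sample is again independent with the same marginals, so it has the law of
  \<open>data\<close>; its maximizers are the reflected ones.\<close>

lemma prob_mle_in_reflect:
  assumes a: "a \<bullet> \<theta> = 0" and C: "mle_in n C \<in> sets (data_space n)"
  shows "emeasure M {\<omega> \<in> space M. data \<omega> \<in> mle_in n (reflect a -` C)}
    = emeasure M {\<omega> \<in> space M. data \<omega> \<in> mle_in n C}"
proof -
  let ?D = "\<lambda>\<omega>. \<lambda>i\<in>{..<n}. (reflect a (X i \<omega>), Y i \<omega>)"
  have "indep_vars (\<lambda>_. borel \<Otimes>\<^sub>M borel) (\<lambda>i \<omega>. (\<lambda>z. (reflect a (fst z), snd z)) (X i \<omega>, Y i \<omega>)) {..<n}"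
    by (rule indep_vars_compose2[OF indep]) measurable
  then have ind: "indep_vars (\<lambda>_. borel \<Otimes>\<^sub>M borel) (\<lambda>i \<omega>. (reflect a (X i \<omega>), Y i \<omega>)) {..<n}" by simp
  then have rv: "random_variable (borel \<Otimes>\<^sub>M borel) (\<lambda>\<omega>. (reflect a (X i \<omega>), Y i \<omega>))" if "i < n" for i
    using that by (simp add: indep_vars_def)
  then have D [measurable]: "?D \<in> M \<rightarrow>\<^sub>M data_space n"
    by (intro measurable_restrict) simp
  have "distr M (data_space n) ?D = (\<Pi>\<^sub>M i\<in>{..<n}. distr M (borel \<Otimes>\<^sub>M borel) (\<lambda>\<omega>. (reflect a (X i \<omega>), Y i \<omega>)))"
    using ind n_pos rv by (subst (asm) indep_vars_iff_distr_eq_PiM') auto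
  also have "\<dots> = distr M (data_space n) data"
    unfolding distr_data by (intro PiM_cong obs_law_reflect a) auto
  finally have law: "distr M (data_space n) ?D = distr M (data_space n) data" .
  have mle: "data_mle n (?D \<omega>) b \<longleftrightarrow> data_mle n (data \<omega>) (reflect a b)" for \<omega> b
    unfolding is_mle_reflect[symmetric] by (rule is_mle_cong) (simp_all add: data_def)
  have "(\<exists>b\<in>C. data_mle n (?D \<omega>) b) \<longleftrightarrow> (\<exists>b\<in>reflect a -` C. data_mle n (data \<omega>) b)" for \<omega>
    unfolding mle vimage_reflect by simp
  then have "?D \<omega> \<in> mle_in n C \<longleftrightarrow> data \<omega> \<in> mle_in n (reflect a -` C)" if "\<omega> \<in> space M" for \<omega>
    using measurable_space[OF D that] measurable_space[OF data_measurable that]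
    unfolding mle_in_def mem_Collect_eq by (simp only:)
  then have "emeasure M {\<omega> \<in> space M. data \<omega> \<in> mle_in n (reflect a -` C)}
      = emeasure M {\<omega> \<in> space M. ?D \<omega> \<in> mle_in n C}"
    by (intro arg_cong[where f="emeasure M"] Collect_cong conj_cong refl) simp
  also have "\<dots> = emeasure (distr M (data_space n) ?D) (mle_in n C)"
    using C by (simp add: emeasure_distr vimage_def Int_def conj_commute)
  also have "\<dots> = emeasure M {\<omega> \<in> space M. data \<omega> \<in> mle_in n C}"
    unfolding law using C by (simp add: emeasure_distr vimage_def Int_def conj_commute)
  finally show ?thesis .
qed

end

section \<open>The direction of the MLE\<close>

lemma mem_orthogonal_comp_singleton: "x \<in> {\<theta>}\<^sup>\<bottom> \<longleftrightarrow> x \<bullet> \<theta> = 0"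
  by (simp add: orthogonal_comp_def orthogonal_def inner_commute)

definition residual :: "'a::euclidean_space \<Rightarrow> 'a \<Rightarrow> 'a" where
  "residual \<theta> b = b - alpha \<theta> b *\<^sub>R \<theta>"

lemma residual_inner: "\<theta> \<noteq> 0 \<Longrightarrow> residual \<theta> b \<bullet> \<theta> = 0"
  by (simp add: residual_def alpha_def inner_diff_left power2_norm_eq_inner)

lemma residual_zero_iff: "\<theta> \<noteq> 0 \<Longrightarrow> residual \<theta> b = 0 \<longleftrightarrow> b \<in> span {\<theta>}"
  by (auto simp: residual_def alpha_def span_singleton power2_norm_eq_inner)

lemma residual_reflect: "a \<bullet> \<theta> = 0 \<Longrightarrow> residual \<theta> (reflect a b) = reflect a (residual \<theta> b)"
  by (simp add: residual_def alpha_def inner_reflect_left reflect_fixes linear_diff[OF linear_reflect]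
      linear_scale[OF linear_reflect])

lemma continuous_on_residual: "continuous_on S (residual \<theta>)"
  unfolding residual_def[abs_def] alpha_def divide_inverse by (intro continuous_intros)

lemma measurable_residual [measurable]: "residual \<theta> \<in> borel_measurable borel"
  by (intro borel_measurable_continuous_onI continuous_on_residual)

text \<open>Pythagoras for \<open>b - z\<close>, split into the multiple of \<theta> and
  \<open>residual \<theta> b - z\<close>. It identifies \<open>sigma_sq\<close> as the squared norm
  of the residual.\<close>

lemma closest_point_orthogonal_comp:
  assumes "\<theta> \<noteq> 0"
  shows "closest_point ({\<theta>}\<^sup>\<bottom>) b = residual \<theta> b"
proof (rule closest_point_unique[symmetric])
  show "residual \<theta> b \<in> {\<theta>}\<^sup>\<bottom>" by (simp add: mem_orthogonal_comp_singleton residual_inner assms)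
  show "\<forall>z\<in>{\<theta>}\<^sup>\<bottom>. dist b (residual \<theta> b) \<le> dist b z"
  proof
    fix z assume "z \<in> {\<theta>}\<^sup>\<bottom>"
    then have "orthogonal (alpha \<theta> b *\<^sub>R \<theta>) (residual \<theta> b - z)"
      using residual_inner[OF assms, of b]
      by (simp add: mem_orthogonal_comp_singleton orthogonal_def inner_diff_right inner_commute)
    from norm_add_Pythagorean[OF this]
    have "(norm (b - residual \<theta> b))\<^sup>2 \<le> (norm (b - z))\<^sup>2" by (simp add: residual_def)
    then show "dist b (residual \<theta> b) \<le> dist b z" by (simp add: dist_norm abs_le_square_iff[symmetric])
  qed
qed (auto simp: subspace_orthogonal_comp subspace_imp_convex closed_subspace)

context logistic_sample
begin

lemma mle_direction_uniform:
  assumes dim: "2 \<le> DIM('a)" and \<theta>: "\<theta> \<noteq> 0"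
    and meas: "theta_hat \<in> borel_measurable M"
    and mle: "\<And>\<omega>. \<omega> \<in> mle_exists_event M n X Y \<Longrightarrow>
      is_mle n (\<lambda>i. X i \<omega>) (\<lambda>i. Y i \<omega>) (theta_hat \<omega>)"
    and pos: "0 < prob (mle_exists_event M n X Y)"
  shows "distr (uniform_measure M (mle_exists_event M n X Y)) borel (\<lambda>\<omega>. sgn (residual \<theta> (theta_hat \<omega>)))
    = uniform_on_unit_sphere ({\<theta>}\<^sup>\<bottom>)" (is "?\<nu> = ?U")
proof -
  note [measurable] = meas
  let ?E = "mle_exists_event M n X Y" and ?V = "{\<theta>}\<^sup>\<bottom>"
  let ?Z = "\<lambda>\<omega>. sgn (residual \<theta> (theta_hat \<omega>))" and ?S = "?V \<inter> sphere 0 1"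
  have V: "subspace ?V" by (rule subspace_orthogonal_comp)
  obtain v where v: "v \<noteq> 0" "v \<bullet> \<theta> = 0"
    using orthogonal_to_vector_exists[OF dim, of \<theta>] by (auto simp: orthogonal_def inner_commute)
  have vV: "v \<in> ?V" using v by (simp add: mem_orthogonal_comp_singleton)
  note U = uniform_on_unit_sphere[OF V vV v(1)]
  \<comment> \<open>A set that is not measurable has \<open>measure\<close> zero by convention, so
    positivity already yields measurability.\<close>
  have E [measurable]: "?E \<in> sets M" using pos measure_notin_sets by fastforce
  have E0: "emeasure M ?E \<noteq> 0" "emeasure M ?E \<noteq> \<infinity>"
    using pos by (auto simp: emeasure_eq_measure)
  have exists_iff: "\<omega> \<in> ?E \<longleftrightarrow> (\<exists>b. data_mle n (data \<omega>) b)" if "\<omega> \<in> space M" for \<omega>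
    using that by (simp add: mle_exists_event_def data_mle_data)
  have AE_unique: "AE \<omega> in M. \<omega> \<in> ?E \<longrightarrow>
      (\<forall>b. data_mle n (data \<omega>) b \<longleftrightarrow> b = theta_hat \<omega>) \<and> residual \<theta> (theta_hat \<omega>) \<noteq> 0"
    using AE_not_many_mles AE_mle_not_radial[OF v(2,1)] AE_space
  proof eventually_elim
    case (elim \<omega>)
    have "data_mle n (data \<omega>) (theta_hat \<omega>)" if "\<omega> \<in> ?E"
      using mle[OF that] by (simp add: data_mle_data)
    with elim measurable_space[OF data_measurable elim(3)] show ?case
      unfolding residual_zero_iff[OF \<theta>] many_mles_def mle_in_def by blast
  qed
  interpret UM: prob_space "uniform_measure M ?E" by (rule prob_space_uniform_measure[OF E0])
  have \<nu>_prob: "prob_space ?\<nu>" by (rule UM.prob_space_distr) simp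
  have "AE \<omega> in M. \<omega> \<in> ?E \<longrightarrow> ?Z \<omega> \<in> ?S"
    using AE_unique by eventually_elim
      (auto simp: mem_orthogonal_comp_singleton sgn_div_norm residual_inner[OF \<theta>])
  then have "AE \<omega> in uniform_measure M ?E. ?Z \<omega> \<in> ?S"
    using E0 by (intro AE_uniform_measureI) auto
  moreover have S [measurable]: "?S \<in> sets borel"
    using closed_subspace[OF V] by auto
  moreover have "AE x in ?\<nu>. x \<in> T" if "AE \<omega> in uniform_measure M ?E. ?Z \<omega> \<in> T" "T \<in> sets borel" for T
    using that by (subst AE_distr_iff) auto
  ultimately have \<nu>_S: "AE x in ?\<nu>. x \<in> ?S" by blast
  \<comment> \<open>Excluding a zero residual, where \<open>sgn\<close> is discontinuous, makes this
    set open.\<close>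
  define G where "G x r = {b. residual \<theta> b \<noteq> 0 \<and> sgn (residual \<theta> b) \<in> ball x r}" for x r
  have open_G: "open (G x r)" for x r
  proof -
    have nz: "open {b. residual \<theta> b \<noteq> 0}"
      using continuous_on_residual by (intro open_Collect_neq continuous_on_const) auto
    have "continuous_on {b. residual \<theta> b \<noteq> 0} (\<lambda>b. sgn (residual \<theta> b))"
      by (intro continuous_on_sgn continuous_on_residual) auto
    from continuous_openin_preimage_gen[OF this open_ball, of x r]
    have "open ({b. residual \<theta> b \<noteq> 0} \<inter> (\<lambda>b. sgn (residual \<theta> b)) -` ball x r)"
      using nz openin_open_eq by blast
    then show ?thesis by (simp add: G_def Int_def vimage_def)
  qed
  \<comment> \<open>Almost surely on \<open>?E\<close> the estimator is the only maximizer, so a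
    condition on it becomes an existence statement about the data. The denominator does not depend
    on the ball.\<close>
  have \<nu>_ball: "emeasure ?\<nu> (ball x r)
      = emeasure M {\<omega> \<in> space M. data \<omega> \<in> mle_in n (G x r)} / emeasure M ?E" for x r
  proof -
    have "emeasure ?\<nu> (ball x r) = emeasure M (?E \<inter> {\<omega> \<in> space M. ?Z \<omega> \<in> ball x r}) / emeasure M ?E"
      by (simp add: emeasure_distr vimage_def Int_def conj_commute)
    also have "emeasure M (?E \<inter> {\<omega> \<in> space M. ?Z \<omega> \<in> ball x r})
        = emeasure M {\<omega> \<in> space M. data \<omega> \<in> mle_in n (G x r)}"
    proof (rule emeasure_eq_AE)
      show "AE \<omega> in M. \<omega> \<in> ?E \<inter> {\<omega> \<in> space M. ?Z \<omega> \<in> ball x r}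
          \<longleftrightarrow> \<omega> \<in> {\<omega> \<in> space M. data \<omega> \<in> mle_in n (G x r)}"
        using AE_unique AE_space
      proof eventually_elim
        case (elim \<omega>)
        have "data \<omega> \<in> mle_in n (G x r) \<longleftrightarrow> (\<exists>b\<in>G x r. data_mle n (data \<omega>) b)"
          using measurable_space[OF data_measurable elim(2)] by (simp add: mle_in_def)
        also have "\<dots> \<longleftrightarrow> \<omega> \<in> ?E \<and> ?Z \<omega> \<in> ball x r"
        proof (cases "\<omega> \<in> ?E")
          case True
          with elim show ?thesis by (simp add: G_def)
        next
          case False
          with exists_iff[OF elim(2)] show ?thesis by blast
        qed
        finally show ?case using elim(2) by blast
      qed
      show "{\<omega> \<in> space M. data \<omega> \<in> mle_in n (G x r)} \<in> sets M"
        using measurable_sets[OF data_measurable mle_in_open[OF open_G]]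
        by (simp add: vimage_def Int_def conj_commute)
    qed simp
    finally show ?thesis .
  qed
  have swap: "\<exists>a. a \<in> ?V \<and> a \<bullet> \<theta> = 0 \<and> reflect a x = y" if "x \<in> ?S" "y \<in> ?S" for x y
    using that reflect_swap[of x y] subspace_diff[OF V, of x y]
    by (intro exI[of _ "x - y"]) (auto simp: mem_orthogonal_comp_singleton)
  have \<nu>_const: "emeasure ?\<nu> (ball x r) = emeasure ?\<nu> (ball y r)" if xy: "x \<in> ?S" "y \<in> ?S" for x y r
  proof -
    obtain a where a: "a \<bullet> \<theta> = 0" "reflect a x = y" using swap[OF xy] by blast
    \<comment> \<open>Taking residuals and normalizing both commute with a reflection that fixes
      \<theta>.\<close>
    have "reflect a -` G x r = G y r"
      unfolding G_def a(2)[symmetric] vimage_reflect_ball[symmetric]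
      by (auto simp: residual_reflect[OF a(1)] sgn_reflect) (metis norm_reflect norm_eq_zero)+
    then show ?thesis
      unfolding \<nu>_ball using prob_mle_in_reflect[OF a(1) mle_in_open[OF open_G], of x r] by simp
  qed
  have U_const: "emeasure ?U (ball x r) = emeasure ?U (ball y r)" if xy: "x \<in> ?S" "y \<in> ?S" for x y r
  proof -
    obtain a where a: "a \<in> ?V" "reflect a x = y" using swap[OF xy] by blast
    have "emeasure ?U (ball x r) = emeasure (distr ?U borel (reflect a)) (ball x r)"
      by (simp add: U(3)[OF a(1)])
    also have "\<dots> = emeasure ?U (ball y r)"
      using a(2) sets_eq_imp_space_eq[OF sets_uniform_on_unit_sphere[of ?V]]
      by (subst emeasure_distr) (auto simp: vimage_reflect_ball)
    finally show ?thesis .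
  qed
  have x0: "sgn v \<in> ?S"
    using v by (simp add: mem_orthogonal_comp_singleton sgn_div_norm)
  have eq: "emeasure ?\<nu> (ball (sgn v) r) = emeasure ?U (ball (sgn v) r)" for r
    by (rule ball_masses_eq[of ?\<nu> ?U ?S r])
      (use \<nu>_prob U(1,2) \<nu>_S \<nu>_const[OF _ x0] U_const[OF _ x0] in auto)
  interpret \<nu>: prob_space ?\<nu> by (rule \<nu>_prob)
  show ?thesis
  proof (rule measure_eq_if_ball_masses_eq[where S="?S" and h="\<lambda>r. emeasure ?\<nu> (ball (sgn v) r)"])
    show "emeasure ?\<nu> UNIV \<noteq> 0" using \<nu>.emeasure_space_1 by simp
    show "emeasure ?\<nu> (ball x r) = emeasure ?\<nu> (ball (sgn v) r)" if "x \<in> ?S" for x r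
      by (rule \<nu>_const[OF that x0])
    show "emeasure ?U (ball x r) = emeasure ?\<nu> (ball (sgn v) r)" if "x \<in> ?S" for x r
      unfolding eq by (rule U_const[OF that x0])
  qed (use \<nu>_S U(2) in \<open>auto simp: \<nu>.emeasure_eq_measure\<close>)
qed

end

theorem lemma2p1:
  fixes M :: "'w measure"
    and n :: nat
    and \<theta> :: "real ^ 'p"
    and X :: "nat \<Rightarrow> 'w \<Rightarrow> real ^ 'p"
    and Y :: "nat \<Rightarrow> 'w \<Rightarrow> real"
    and theta_hat :: "'w \<Rightarrow> real ^ 'p"
  assumes "n \<ge> 1" and "CARD('p) \<ge> 2" and "\<theta> \<noteq> 0"
    and model: "logistic_model M n \<theta> X Y"
    and theta_hat_measurable: "theta_hat \<in> borel_measurable M"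
    and theta_hat_mle: "\<And>\<omega>. \<omega> \<in> mle_exists_event M n X Y \<Longrightarrow>
           is_mle n (\<lambda>i. X i \<omega>) (\<lambda>i. Y i \<omega>) (theta_hat \<omega>)"
    and mle_exists: "measure M (mle_exists_event M n X Y) > 0"
  shows "distr (uniform_measure M (mle_exists_event M n X Y)) borel
           (\<lambda>\<omega>. (theta_hat \<omega> - alpha \<theta> (theta_hat \<omega>) *\<^sub>R \<theta>) /\<^sub>R sqrt (sigma_sq \<theta> (theta_hat \<omega>)))
         = uniform_on_unit_sphere ({\<theta>}\<^sup>\<bottom>)"
proof -
  interpret prob_space M using model by (simp add: logistic_model_def)
  interpret logistic_sample M n \<theta> X Y
    by unfold_locales (use assms in auto)
  \<comment> \<open>This holds for every \<omega>: where the residual vanishes, both sides are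
    zero.\<close>
  have "(theta_hat \<omega> - alpha \<theta> (theta_hat \<omega>) *\<^sub>R \<theta>) /\<^sub>R sqrt (sigma_sq \<theta> (theta_hat \<omega>))
      = sgn (residual \<theta> (theta_hat \<omega>))" for \<omega>
    using \<open>\<theta> \<noteq> 0\<close> by (simp add: sigma_sq_def closest_point_orthogonal_comp residual_def sgn_div_norm)
  then show ?thesis
    using mle_direction_uniform[OF _ assms(3) theta_hat_measurable theta_hat_mle mle_exists] assms(2)
    by simp
qed

end
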